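(* Let $X_1,X_2,\dots$ be i.i.d. with distribution $P_0$ on $\mathcal X$, and let $\theta^*$ be an interior point of $\Theta\subseteq\mathbb R^p$. Let $\boldsymbol\alpha=(\alpha_i)_{i\ge1}$ be a deterministic sequence of positive weights with finite second moment, i.e. $\limsup_{n}\frac1n\sum_{i=1}^n\alpha_i^2<\infty$. Suppose the prior density $\pi$ is continuous and strictly positive on a neighborhood of $\theta^*$, and that the Weighted M-LAN condition and the $\sqrt n$-concentration condition (both defined in the context) hold. Then $$d_{\mathrm{TV}}\Big(\pi_n^\rho(\cdot\mid F_n^{\boldsymbol\alpha}),\ \phi\big(\cdot\mid \hat\theta^{\boldsymbol\alpha}_\rho,\ V_{\theta^*}^{-1}/(\bar\alpha_n n)\big)\Big)\to 0$$ in $P_0$-probability, where $\phi(\cdot\mid\mu,\Sigma)$ is the $N(\mu,\Sigma)$ density, $\bar\alpha_n=n^{-1}\sum_{i=1}^n\alpha_i$, and $V_{\theta^*}$ is the positive definite matrix from the Weighted M-LAN condition.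
   Context: Loss $\rho:\mathcal X\times\Theta\to\mathbb R_{\ge0}$, $\Theta\subseteq\mathbb R^p$, with score $\psi(x,\theta)=\nabla_\theta\rho(x,\theta)$. Weighted empirical measure: $F_n^{\boldsymbol\alpha}=\frac1n\sum_{i=1}^n\alpha_i\delta_{X_i}$ (not necessarily a probability measure), so $\mathbb E_{F_n^{\boldsymbol\alpha}}[g(X)]=\frac1n\sum_i\alpha_i g(X_i)$. Weighted M-estimator $\hat\theta^{\boldsymbol\alpha}_\rho$: a solution of $\frac1n\sum_{i=1}^n\alpha_i\psi(X_i,\theta)=0$. Weighted M-posterior: the density $$\pi_n^\rho(\theta\mid F_n^{\boldsymbol\alpha})=\frac{\exp(-\sum_{i=1}^n\alpha_i\rho(X_i,\theta))\pi(\theta)}{\int_\Theta\exp(-\sum_{i=1}^n\alpha_i\rho(X_i,\theta'))\pi(\theta')\,d\theta'}.$$ Weighted M-LAN condition: there is a positive definite matrix $V_{\theta^*}$ such that, with $$R_{n,\boldsymbol\alpha}(h)=\sum_{i=1}^n\alpha_i\big(\rho(X_i,\theta^* )-\rho(X_i,\theta^*+h/\sqrt n)\big)-h^\top\bar\alpha_nV_{\theta^*}\sqrt n(\hat\theta^{\boldsymbol\alpha}_\rho-\theta^* )+\tfrac12h^\top\bar\alpha_nV_{\theta^*}h,$$ $\sup_{h\in K}|R_{n,\boldsymbol\alpha}(h)|\to0$ in $P_0$-probability for every compact $K\subseteq\mathbb R^p$. Concentration condition: for every sequence $r_n\to\infty$, $\mathbb E_{P_0}\big[\int_\Theta\mathbf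 1\{\|\sqrt n(\theta-\theta^* )\|>r_n\}\pi_n^\rho(\theta\mid F_n^{\boldsymbol\alpha})d\theta\big]\to0$. $d_{\mathrm{TV}}$ is total variation distance. *)

theory Defs
  imports "HOL-Probability.Probability"
begin

text \<open>Convergence to 0 in (outer) probability: for every eps > 0 the events
  where the modulus exceeds eps are covered by measurable events of vanishing probability.\<close>
definition tendsto_zero_in_prob :: "'a measure \<Rightarrow> (nat \<Rightarrow> 'a \<Rightarrow> real) \<Rightarrow> bool" where
  "tendsto_zero_in_prob M Y \<longleftrightarrow>
     (\<forall>\<epsilon>>0. \<exists>E. (\<forall>n. E n \<in> sets M \<and> {\<omega> \<in> space M. \<epsilon> < \<bar>Y n \<omega>\<bar>} \<subseteq> E n)
                 \<and> (\<lambda>n. measure M (E n)) \<longlonglongrightarrow> 0)"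

definition sup_tendsto_zero_in_prob :: "'a measure \<Rightarrow> 'b set \<Rightarrow> (nat \<Rightarrow> 'a \<Rightarrow> 'b \<Rightarrow> real) \<Rightarrow> bool" where
  "sup_tendsto_zero_in_prob M K Y \<longleftrightarrow>
     (\<forall>\<epsilon>>0. \<exists>E. (\<forall>n. E n \<in> sets M \<and> {\<omega> \<in> space M. \<exists>h\<in>K. \<epsilon> < \<bar>Y n \<omega> h\<bar>} \<subseteq> E n)
                 \<and> (\<lambda>n. measure M (E n)) \<longlonglongrightarrow> 0)"

definition pos_def_mat :: "real^'p^'p \<Rightarrow> bool" where
  "pos_def_mat V \<longleftrightarrow> transpose V = V \<and> (\<forall>h. h \<noteq> 0 \<longrightarrow> 0 < h \<bullet> (V *v h))"

definition normal_density :: "real^'p \<Rightarrow> real^'p^'p \<Rightarrow> real^'p \<Rightarrow> real" where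
  "normal_density \<mu> \<Sigma> \<theta> =
     exp (- (1/2) * ((\<theta> - \<mu>) \<bullet> (matrix_inv \<Sigma> *v (\<theta> - \<mu>))))
     / sqrt ((2 * pi) ^ CARD('p) * det \<Sigma>)"

definition wloss :: "(nat \<Rightarrow> real) \<Rightarrow> ('x \<Rightarrow> real^'p \<Rightarrow> real) \<Rightarrow> (nat \<Rightarrow> 'x) \<Rightarrow> nat \<Rightarrow> real^'p \<Rightarrow> real" where
  "wloss \<alpha> \<rho> x n \<theta> = (\<Sum>i<n. \<alpha> i * \<rho> (x i) \<theta>)"

definition alpha_bar :: "(nat \<Rightarrow> real) \<Rightarrow> nat \<Rightarrow> real" where
  "alpha_bar \<alpha> n = (\<Sum>i<n. \<alpha> i) / real n"

definition post_norm :: "(real^'p) set \<Rightarrow> (real^'p \<Rightarrow> real) \<Rightarrow> (nat \<Rightarrow> real) \<Rightarrow> ('x \<Rightarrow> real^'p \<Rightarrow> real)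
    \<Rightarrow> (nat \<Rightarrow> 'x) \<Rightarrow> nat \<Rightarrow> real" where
  "post_norm \<Theta> \<pi> \<alpha> \<rho> x n =
     (LINT \<theta>|lborel. indicator \<Theta> \<theta> * exp (- wloss \<alpha> \<rho> x n \<theta>) * \<pi> \<theta>)"

definition M_posterior :: "(real^'p) set \<Rightarrow> (real^'p \<Rightarrow> real) \<Rightarrow> (nat \<Rightarrow> real) \<Rightarrow> ('x \<Rightarrow> real^'p \<Rightarrow> real)
    \<Rightarrow> (nat \<Rightarrow> 'x) \<Rightarrow> nat \<Rightarrow> real^'p \<Rightarrow> real" where
  "M_posterior \<Theta> \<pi> \<alpha> \<rho> x n \<theta> =
     indicator \<Theta> \<theta> * exp (- wloss \<alpha> \<rho> x n \<theta>) * \<pi> \<theta> / post_norm \<Theta> \<pi> \<alpha> \<rho> x n"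

definition dTV_dens :: "(real^'p \<Rightarrow> real) \<Rightarrow> (real^'p \<Rightarrow> real) \<Rightarrow> real" where
  "dTV_dens f g = (1/2) * (LINT \<theta>|lborel. \<bar>f \<theta> - g \<theta>\<bar>)"

definition LAN_rem :: "(nat \<Rightarrow> real) \<Rightarrow> ('x \<Rightarrow> real^'p \<Rightarrow> real) \<Rightarrow> (nat \<Rightarrow> 'x) \<Rightarrow> real^'p^'p
    \<Rightarrow> real^'p \<Rightarrow> real^'p \<Rightarrow> nat \<Rightarrow> real^'p \<Rightarrow> real" where
  "LAN_rem \<alpha> \<rho> x V \<theta>s th n h =
     (\<Sum>i<n. \<alpha> i * (\<rho> (x i) \<theta>s - \<rho> (x i) (\<theta>s + (1 / sqrt (real n)) *\<^sub>R h)))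
     - h \<bullet> (alpha_bar \<alpha> n *\<^sub>R (V *v (sqrt (real n) *\<^sub>R (th - \<theta>s))))
     + (1/2) * (h \<bullet> (alpha_bar \<alpha> n *\<^sub>R (V *v h)))"

end

theory Submission
  imports Defs
begin

text \<open>
  By the LAN expansion and continuity of the prior, the posterior density is, up to a factor close
  to 1, proportional to the density of \<open>N(\<theta>\<^sub>h, V^{-1} / (\<alpha>\<^sub>n n))\<close>
  on balls of radius of order \<open>1 / \<surd>n\<close> around \<open>\<theta>\<^sub>s\<close>. Two such densities are close in total variation
  as soon as both are concentrated on such a ball. For the posterior this is assumed. For the
  Gaussian it is forced: neither \<open>\<alpha>\<^sub>n \<longrightarrow> 0\<close> nor \<open>\<surd>n \<parallel>\<theta>\<^sub>h - \<theta>\<^sub>s\<parallel> \<longrightarrow> \<infinity>\<close> is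
  compatible with concentration, because the posterior mass of the ball would then be
  comparable to the mass of a disjoint translate of it.
\<close>

section \<open>Linear changes of variables\<close>

text \<open>The obstacle is uniformity. The LAN expansion is controlled only on compact sets of the
  rescaled parameter h = sqrt n * (\<theta> - \<open>\<theta>s\<close>), while total variation sees
  the whole space. Concentration is assumed along radii that tend to infinity; since it holds for
  all such sequences, one fixed radius R already works. The expansion is then used on a larger fixed
  radius R', with room for a disjoint translate of the R-ball, for the offset of the estimator and
  for the Gaussian tail. The choices are made in the order \<epsilon>, R, R', n, and none of them
  depends on the sample point. Randomness enters through two exceptional events only: one is bounded
  by Markov's inequality for the posterior mass outside the R-ball, the other comes from the LAN
  condition. Off both, the argument is deterministic. The two normalising constants are not compared
  by computation: their ratio is close to 1 because both densities have almost unit mass on a common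
  ball. The change of variables serves the determinant in the Gaussian normalising constant.\<close>

definition lborel_scales :: "real^'n^'n \<Rightarrow> bool" where
  "lborel_scales A \<longleftrightarrow> (det A \<noteq> 0 \<longrightarrow> (\<forall>f\<in>borel_measurable borel.
     (\<integral>\<^sup>+x. f x \<partial>lborel) = ennreal \<bar>det A\<bar> * (\<integral>\<^sup>+x. f (A *v x) \<partial>lborel)))"

lemma measurable_matrix_vector_mult [measurable]: "(*v) (A :: real^'n^'n) \<in> borel_measurable borel"
  by (intro borel_measurable_continuous_onI matrix_vector_mult_linear_continuous_on)

text \<open>Diagonal matrices and coordinate swaps send boxes to boxes, so for them an identity of
  measures is within reach. A shear does not, and is handled through integrals.\<close>

lemma lborel_scalesI:
  fixes A :: "real^'n^'n"
  assumes "det A \<noteq> 0 \<Longrightarrow> lborel = density (distr lborel borel ((*v) A)) (\<lambda>_. ennreal \<bar>det A\<bar>)"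
  shows "lborel_scales A"
  unfolding lborel_scales_def
proof (intro impI ballI)
  fix f :: "real^'n \<Rightarrow> ennreal" assume [measurable]: "f \<in> borel_measurable borel" and "det A \<noteq> 0"
  have "(\<integral>\<^sup>+x. f x \<partial>lborel) = (\<integral>\<^sup>+x. f x \<partial>density (distr lborel borel ((*v) A)) (\<lambda>_. ennreal \<bar>det A\<bar>))"
    using assms[OF \<open>det A \<noteq> 0\<close>] by simp
  also have "\<dots> = ennreal \<bar>det A\<bar> * (\<integral>\<^sup>+x. f (A *v x) \<partial>lborel)"
    by (simp add: nn_integral_density nn_integral_distr nn_integral_cmult)
  finally show "(\<integral>\<^sup>+x. f x \<partial>lborel) = ennreal \<bar>det A\<bar> * (\<integral>\<^sup>+x. f (A *v x) \<partial>lborel)" .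
qed

lemma lborel_scales_mult:
  fixes A B :: "real^'n^'n"
  assumes "lborel_scales A" "lborel_scales B"
  shows "lborel_scales (A ** B)"
  unfolding lborel_scales_def
proof (intro impI ballI)
  fix f :: "real^'n \<Rightarrow> ennreal" assume f[measurable]: "f \<in> borel_measurable borel" and "det (A ** B) \<noteq> 0"
  then have A: "det A \<noteq> 0" and B: "det B \<noteq> 0" by (auto simp: det_mul)
  have "(\<integral>\<^sup>+x. f x \<partial>lborel) = ennreal \<bar>det A\<bar> * (\<integral>\<^sup>+x. f (A *v x) \<partial>lborel)"
    using assms(1) A f unfolding lborel_scales_def by blast
  also have "(\<integral>\<^sup>+x. f (A *v x) \<partial>lborel) = ennreal \<bar>det B\<bar> * (\<integral>\<^sup>+x. f (A *v (B *v x)) \<partial>lborel)"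
  proof -
    have "(\<lambda>x. f (A *v x)) \<in> borel_measurable borel" by measurable
    then show ?thesis using assms(2) B unfolding lborel_scales_def by blast
  qed
  finally show "(\<integral>\<^sup>+x. f x \<partial>lborel) = ennreal \<bar>det (A ** B)\<bar> * (\<integral>\<^sup>+x. f (A ** B *v x) \<partial>lborel)"
    by (simp add: det_mul abs_mult ennreal_mult' mult.assoc matrix_vector_mul_assoc)
qed

lemma lborel_scales_diagonal:
  assumes diag: "\<And>i j. i \<noteq> j \<Longrightarrow> A $ i $ j = 0"
  shows "lborel_scales (A :: real^'n^'n)"
proof (rule lborel_scalesI)
  assume "det A \<noteq> 0"
  then have nz: "A $ i $ i \<noteq> 0" for i by (auto simp: det_diagonal[OF diag])
  \<comment> \<open>\<open>lborel_affine_euclidean\<close> wants one factor per basis vector; this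
    form reads the diagonal entry off the vector without naming its index.\<close>
  define c :: "real^'n \<Rightarrow> real" where "c b = b \<bullet> (A *v b)" for b
  have c_axis: "c (axis i 1) = A $ i $ i" for i
    by (simp add: c_def inner_axis' matrix_vector_mul_component) (simp add: inner_axis)
  have nzc: "c b \<noteq> 0" if "b \<in> Basis" for b
    using that nz by (auto simp: Basis_vec_def c_axis)
  have img: "(Basis :: (real^'n) set) = (\<lambda>i. axis i 1) ` UNIV" by (auto simp: Basis_vec_def)
  have inj: "inj (\<lambda>i::'n. axis i (1::real))" by (auto simp: inj_on_def axis_eq_axis)
  have "0 + (\<Sum>j\<in>Basis. (c j * (x \<bullet> j)) *\<^sub>R j) = A *v x" for x
  proof (subst vec_eq_iff, intro allI)
    fix i
    have "(\<Sum>j\<in>Basis. (c j * (x \<bullet> j)) *\<^sub>R j) $ i = (\<Sum>j\<in>UNIV. A $ j $ j * x $ j * (if j = i then 1 else 0))"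
      unfolding img by (subst sum.reindex[OF inj]) (auto simp: c_axis inner_axis intro!: sum.cong, simp add: axis_def)
    also have "\<dots> = A $ i $ i * x $ i" by (simp add: if_distrib cong: if_cong)
    also have "\<dots> = (\<Sum>j\<in>UNIV. if j = i then A $ i $ i * x $ i else 0)" by simp
    also have "\<dots> = (\<Sum>j\<in>UNIV. A $ i $ j * x $ j)"
      using diag by (intro sum.cong) auto
    finally show "(0 + (\<Sum>j\<in>Basis. (c j * (x \<bullet> j)) *\<^sub>R j)) $ i = (A *v x) $ i"
      by (simp add: matrix_vector_mult_def)
  qed
  moreover have "(\<Prod>j\<in>Basis. \<bar>c j\<bar>) = \<bar>det A\<bar>"
    unfolding img by (subst prod.reindex[OF inj]) (simp add: c_axis det_diagonal diag abs_prod)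
  ultimately show "lborel = density (distr lborel borel ((*v) A)) (\<lambda>_. ennreal \<bar>det A\<bar>)"
    using lborel_affine_euclidean[of c 0, OF nzc] by (simp add: prod_ennreal)
qed

text \<open>A coordinate swap only reorders the side lengths of a box, and boxes determine Lebesgue
  measure.\<close>

lemma lborel_scales_transpose:
  fixes m n :: "'n::finite"
  defines "A \<equiv> (\<chi> i j. (mat 1 :: real^'n^'n) $ i $ Transposition.transpose m n j)"
  assumes "m \<noteq> n"
  shows "lborel_scales A"
proof (rule lborel_scalesI)
  let ?\<tau> = "Transposition.transpose m n"
  have "\<bar>det A\<bar> = 1"
    unfolding A_def by (subst det_permute_columns) (auto simp: permutes_swap_id sign_swap_id)
  have Ax: "(A *v x) $ i = x $ ?\<tau> i" for x i
  proof -
    have "(A *v x) $ i = (\<Sum>j\<in>UNIV. (if i = ?\<tau> j then 1 else 0) * x $ j)"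
      by (simp add: A_def matrix_vector_mult_def mat_def)
    also have "\<dots> = (\<Sum>j\<in>UNIV. if j = ?\<tau> i then x $ j else 0)"
      by (intro sum.cong refl) (metis mult_1 mult_zero_left transpose_involutory)
    finally show ?thesis by simp
  qed
  have "lborel = distr lborel borel ((*v) A)"
  proof (rule lborel_eqI)
    fix l u :: "real^'n" assume le: "\<And>b. b \<in> Basis \<Longrightarrow> l \<bullet> b \<le> u \<bullet> b"
    have "(*v) A -` box l u = box (\<chi> i. l $ ?\<tau> i) (\<chi> i. u $ ?\<tau> i)"
      by (auto simp: mem_box_cart Ax) (metis transpose_involutory)+
    then have "emeasure (distr lborel borel ((*v) A)) (box l u) = emeasure lborel (box (\<chi> i. l $ ?\<tau> i) (\<chi> i. u $ ?\<tau> i))"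
      by (simp add: emeasure_distr)
    also have "\<dots> = (\<Prod>b\<in>Basis. ((\<chi> i. u $ ?\<tau> i) - (\<chi> i. l $ ?\<tau> i)) \<bullet> b)"
    proof -
      have "l $ i \<le> u $ i" for i using le[of "axis i 1"] by (simp add: inner_axis)
      then show ?thesis by (subst emeasure_lborel_box) (auto simp: Basis_vec_def inner_axis)
    qed
    also have "\<dots> = (\<Prod>b\<in>Basis. (u - l) \<bullet> b)"
    proof -
      have img: "(Basis :: (real^'n) set) = (\<lambda>i. axis i 1) ` UNIV" by (auto simp: Basis_vec_def)
      have inj: "inj (\<lambda>i::'n. axis i (1::real))" by (auto simp: inj_on_def axis_eq_axis)
      show ?thesis unfolding img
        using prod.permute[OF permutes_swap_id, of m UNIV n "\<lambda>i. (u - l) $ i"]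
        by (subst (1 2) prod.reindex[OF inj]) (simp add: inner_axis o_def)
    qed
    finally show "emeasure (distr lborel borel ((*v) A)) (box l u) = (\<Prod>b\<in>Basis. (u - l) \<bullet> b)" .
  qed simp
  then show "lborel = density (distr lborel borel ((*v) A)) (\<lambda>_. ennreal \<bar>det A\<bar>)"
    using \<open>\<bar>det A\<bar> = 1\<close> by (simp add: density_1)
qed

lemma nn_integral_lborel_translate:
  fixes f :: "'a::euclidean_space \<Rightarrow> ennreal"
  assumes [measurable]: "f \<in> borel_measurable borel"
  shows "(\<integral>\<^sup>+x. f (x + c) \<partial>lborel) = (\<integral>\<^sup>+x. f x \<partial>lborel)"
proof -
  have "(\<integral>\<^sup>+x. f x \<partial>lborel) = (\<integral>\<^sup>+x. f x \<partial>distr lborel borel ((+) c))" by (simp add: lborel_distr_plus)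
  also have "\<dots> = (\<integral>\<^sup>+x. f (x + c) \<partial>lborel)" by (subst nn_integral_distr) (auto simp: add.commute)
  finally show ?thesis ..
qed

text \<open>Only Tonelli and translation invariance are used: with the weight \<open>\<psi> = 1\<^bsub>[0,1]\<^esub>\<close> inserted
  in the direction \<open>e\<close>, the amount \<open>g x\<close> of shearing is absorbed by the one-dimensional
  integral.\<close>
lemma nn_integral_lborel_shear:
  fixes f :: "'a::euclidean_space \<Rightarrow> ennreal" and g :: "'a \<Rightarrow> real"
  assumes [measurable]: "f \<in> borel_measurable borel" "g \<in> borel_measurable borel"
    and e: "e \<bullet> e = 1" and g: "\<And>x s. g (x + s *\<^sub>R e) = g x"
  shows "(\<integral>\<^sup>+x. f (x + g x *\<^sub>R e) \<partial>lborel) = (\<integral>\<^sup>+x. f x \<partial>lborel)"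
proof -
  define \<psi> :: "real \<Rightarrow> ennreal" where "\<psi> = indicator {0..1}"
  have [measurable]: "\<psi> \<in> borel_measurable borel" by (simp add: \<psi>_def)
  have \<psi>1: "(\<integral>\<^sup>+s. \<psi> (c + s) \<partial>lborel) = 1" for c
    using nn_integral_lborel_translate[of \<psi> c] by (simp add: \<psi>_def add.commute)
  \<comment> \<open>The right-hand side does not mention \<open>g\<close>, so comparing this for
    \<open>g\<close> and for the zero function gives the claim.\<close>
  have *: "(\<integral>\<^sup>+x. f (x + g x *\<^sub>R e) \<partial>lborel) = (\<integral>\<^sup>+x. \<psi> (x \<bullet> e) * (\<integral>\<^sup>+s. f (x + (- s) *\<^sub>R e) \<partial>lborel) \<partial>lborel)"
    if [measurable]: "g \<in> borel_measurable borel" and g: "\<And>x s. g (x + s *\<^sub>R e) = g x" for g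
  proof -
    have "(\<integral>\<^sup>+x. f (x + g x *\<^sub>R e) \<partial>lborel) = (\<integral>\<^sup>+x. (\<integral>\<^sup>+s. f (x + g x *\<^sub>R e) * \<psi> (x \<bullet> e + s) \<partial>lborel) \<partial>lborel)"
      by (simp add: nn_integral_cmult \<psi>1)
    also have "\<dots> = (\<integral>\<^sup>+s. (\<integral>\<^sup>+x. f (x + g x *\<^sub>R e) * \<psi> (x \<bullet> e + s) \<partial>lborel) \<partial>lborel)"
      by (subst lborel_pair.Fubini') auto
    also have "\<dots> = (\<integral>\<^sup>+s. (\<integral>\<^sup>+x. f (x + (g x - s) *\<^sub>R e) * \<psi> (x \<bullet> e) \<partial>lborel) \<partial>lborel)"
    proof (rule nn_integral_cong)
      fix s :: real
      \<comment> \<open>Translating by a multiple of \<open>e\<close> leaves the amount of shearing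
        alone, because \<open>g\<close> is constant along \<open>e\<close>.\<close>
      have "(\<integral>\<^sup>+x. f (x + g x *\<^sub>R e) * \<psi> (x \<bullet> e + s) \<partial>lborel)
          = (\<integral>\<^sup>+x. f ((x + (- s) *\<^sub>R e) + g (x + (- s) *\<^sub>R e) *\<^sub>R e) * \<psi> ((x + (- s) *\<^sub>R e) \<bullet> e + s) \<partial>lborel)"
        by (rule nn_integral_lborel_translate[symmetric]) measurable
      also have "\<dots> = (\<integral>\<^sup>+x. f (x + (g x - s) *\<^sub>R e) * \<psi> (x \<bullet> e) \<partial>lborel)"
        unfolding g by (simp add: inner_add_left e algebra_simps)
      finally show "(\<integral>\<^sup>+x. f (x + g x *\<^sub>R e) * \<psi> (x \<bullet> e + s) \<partial>lborel)
          = (\<integral>\<^sup>+x. f (x + (g x - s) *\<^sub>R e) * \<psi> (x \<bullet> e) \<partial>lborel)" .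
    qed
    also have "\<dots> = (\<integral>\<^sup>+x. (\<integral>\<^sup>+s. f (x + (g x - s) *\<^sub>R e) * \<psi> (x \<bullet> e) \<partial>lborel) \<partial>lborel)"
      by (subst lborel_pair.Fubini') auto
    also have "\<dots> = (\<integral>\<^sup>+x. \<psi> (x \<bullet> e) * (\<integral>\<^sup>+s. f (x + (- s) *\<^sub>R e) \<partial>lborel) \<partial>lborel)"
    proof (rule nn_integral_cong)
      fix x :: 'a
      have "(\<integral>\<^sup>+s. f (x + (g x - s) *\<^sub>R e) \<partial>lborel) = (\<integral>\<^sup>+s. f (x + (- (s + - g x)) *\<^sub>R e) \<partial>lborel)"
        by (simp add: algebra_simps)
      also have "\<dots> = (\<integral>\<^sup>+s. f (x + (- s) *\<^sub>R e) \<partial>lborel)"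
        by (rule nn_integral_lborel_translate) measurable
      finally show "(\<integral>\<^sup>+s. f (x + (g x - s) *\<^sub>R e) * \<psi> (x \<bullet> e) \<partial>lborel)
          = \<psi> (x \<bullet> e) * (\<integral>\<^sup>+s. f (x + (- s) *\<^sub>R e) \<partial>lborel)"
        by (simp add: nn_integral_multc mult.commute[of "\<psi> _"])
    qed
    finally show ?thesis .
  qed
  show ?thesis using *[of g] *[of "\<lambda>_. 0"] g by simp
qed

text \<open>The matrix adds \<open>x $ n\<close> times the axis \<open>m\<close>; since
  \<open>m \<noteq> n\<close>, that coordinate does not change along the axis.\<close>

lemma lborel_scales_shear:
  fixes m n :: "'n::finite"
  defines "A \<equiv> (\<chi> i j. of_bool (i = m \<and> j = n \<or> i = j)) :: real^'n^'n"
  assumes "m \<noteq> n"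
  shows "lborel_scales A"
  unfolding lborel_scales_def
proof (intro impI ballI)
  fix f :: "real^'n \<Rightarrow> ennreal" assume f: "f \<in> borel_measurable borel"
  have "A = (\<chi> k. if k = m then row m (mat 1) + 1 *s row n (mat 1) else row k (mat 1))"
    unfolding A_def using \<open>m \<noteq> n\<close> by (auto simp: vec_eq_iff row_def mat_def)
  then have "det A = 1" using det_row_operation[OF \<open>m \<noteq> n\<close>, of "mat 1" 1] by simp
  have Ax: "A *v x = x + (x $ n) *\<^sub>R axis m 1" for x
  proof (subst vec_eq_iff, intro allI)
    fix i
    have "(A *v x) $ i = (\<Sum>j\<in>UNIV. (if j = i then x $ j else 0) + (if j = n then (if i = m then x $ j else 0) else 0))"
      unfolding A_def matrix_vector_mult_def using \<open>m \<noteq> n\<close> by (auto intro!: sum.cong)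
    then show "(A *v x) $ i = (x + (x $ n) *\<^sub>R axis m 1) $ i"
      by (simp add: sum.distrib axis_def)
  qed
  have "(\<integral>\<^sup>+x. f (x + (x $ n) *\<^sub>R axis m 1) \<partial>lborel) = (\<integral>\<^sup>+x. f x \<partial>lborel)"
  proof (rule nn_integral_lborel_shear[OF f])
    show "(\<lambda>x::real^'n. x $ n) \<in> borel_measurable borel"
      by (intro borel_measurable_continuous_onI continuous_intros)
  qed (use \<open>m \<noteq> n\<close> in \<open>simp_all add: inner_axis_axis\<close>, simp add: axis_def)
  then show "(\<integral>\<^sup>+x. f x \<partial>lborel) = ennreal \<bar>det A\<bar> * (\<integral>\<^sup>+x. f (A *v x) \<partial>lborel)"
    by (simp add: Ax \<open>det A = 1\<close>)
qed

text \<open>Induction over elementary matrices. The guard \<open>det A \<noteq> 0\<close> inside the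
  predicate makes the zero-row case vacuous, and it passes to both factors of a product by
  multiplicativity of the determinant.\<close>

lemma lborel_scales: "lborel_scales (A :: real^'n^'n)"
proof (rule induct_matrix_elementary_alt)
  show "lborel_scales A" if "row i A = 0" for A :: "real^'n^'n" and i
    using det_zero_row(1)[OF that] by (simp add: lborel_scales_def)
qed (fact lborel_scales_mult lborel_scales_diagonal lborel_scales_transpose lborel_scales_shear)+

lemma nn_integral_lborel_linear:
  fixes A :: "real^'n^'n"
  assumes "f \<in> borel_measurable borel" "det A \<noteq> 0"
  shows "(\<integral>\<^sup>+x. f x \<partial>lborel) = ennreal \<bar>det A\<bar> * (\<integral>\<^sup>+x. f (A *v x) \<partial>lborel)"
  using lborel_scales[of A] assms unfolding lborel_scales_def by blast

section \<open>Multivariate Gaussian integrals\<close>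

lemma pos_def_mat_sym: "pos_def_mat V \<Longrightarrow> x \<bullet> (V *v y) = y \<bullet> (V *v x)"
  by (metis dot_lmul_matrix inner_commute pos_def_mat_def transpose_matrix_vector)

lemma pos_def_mat_nonneg: "pos_def_mat V \<Longrightarrow> 0 \<le> x \<bullet> (V *v x)"
  by (cases "x = 0") (auto simp: pos_def_mat_def less_imp_le)

lemma pos_def_mat_scaleR: "pos_def_mat V \<Longrightarrow> 0 < c \<Longrightarrow> pos_def_mat (c *\<^sub>R V)"
  by (simp add: pos_def_mat_def transpose_scalar scaleR_matrix_vector_assoc[symmetric])

text \<open>Gram-Schmidt for the inner product defined by \<open>V\<close>; the columns of
  \<open>B\<close> are an orthonormal basis for it. The induction runs over sets of column
  indices.\<close>

lemma pos_def_mat_orthonormal: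
  fixes V :: "real^'p^'p"
  assumes V: "pos_def_mat V"
  shows "\<exists>B :: real^'p^'p. transpose B ** V ** B = mat 1"
proof -
  have "\<exists>b :: 'p \<Rightarrow> real^'p. \<forall>i\<in>S. \<forall>j\<in>S. b i \<bullet> (V *v b j) = (if i = j then 1 else 0)" for S :: "'p set"
    using finite[of S]
  proof (induction S)
    case (insert k S)
    then obtain b :: "'p \<Rightarrow> real^'p"
      where b: "\<And>i j. i \<in> S \<Longrightarrow> j \<in> S \<Longrightarrow> b i \<bullet> (V *v b j) = (if i = j then 1 else 0)"
      by blast
    \<comment> \<open>A dimension count replaces the subtraction of projections: fewer than p
      vectors \<open>V *v b j\<close> leave a nonzero \<open>x\<close> Euclidean-orthogonal to all
      of them, which is \<open>V\<close>-orthogonality to the \<open>b j\<close>.\<close>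
    have "dim ((\<lambda>j. V *v b j) ` S) \<le> card ((\<lambda>j. V *v b j) ` S)"
      by (intro dim_le_card') (use insert in simp)
    also have "\<dots> \<le> card S" by (rule card_image_le) (use insert in simp)
    also have "\<dots> < DIM(real^'p)"
      using psubset_card_mono[of UNIV S] insert.hyps by auto
    finally obtain x where x: "x \<noteq> 0" "\<And>y. y \<in> span ((\<lambda>j. V *v b j) ` S) \<Longrightarrow> orthogonal x y"
      using orthogonal_to_subspace_exists by blast
    have xb: "x \<bullet> (V *v b j) = 0" if "j \<in> S" for j
      using x(2)[OF span_base] that by (auto simp: orthogonal_def)
    have q: "0 < x \<bullet> (V *v x)" using V x(1) by (simp add: pos_def_mat_def)
    define z where "z = (1 / sqrt (x \<bullet> (V *v x))) *\<^sub>R x"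
    have zz: "z \<bullet> (V *v z) = 1"
      using q by (simp add: z_def matrix_vector_mult_scaleR)
    have zb: "z \<bullet> (V *v b j) = 0" "b j \<bullet> (V *v z) = 0" if "j \<in> S" for j
      using xb[OF that] pos_def_mat_sym[OF V, of z "b j"] by (simp_all add: z_def)
    have "\<forall>i\<in>insert k S. \<forall>j\<in>insert k S.
        (b(k := z)) i \<bullet> (V *v (b(k := z)) j) = (if i = j then 1 else 0)"
      using insert.hyps zz zb b by auto
    then show ?case by blast
  qed simp
  from this[of UNIV] obtain b :: "'p \<Rightarrow> real^'p"
    where b: "\<And>i j. b i \<bullet> (V *v b j) = (if i = j then 1 else 0)" by auto
  define B :: "real^'p^'p" where "B = (\<chi> i j. b j $ i)"
  have "(transpose B ** V ** B) $ i $ j = b i \<bullet> (V *v b j)" for i j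
  proof -
    have "(transpose B ** (V ** B)) $ i $ j = b i \<bullet> (V *v b j)"
      by (simp add: matrix_matrix_mult_def transpose_def inner_vec_def matrix_vector_mult_def B_def)
    then show ?thesis by (simp add: matrix_mul_assoc)
  qed
  then have "transpose B ** V ** B = mat 1"
    by (simp add: vec_eq_iff b mat_def)
  then show ?thesis by blast
qed

lemma nn_integral_std_gaussian:
  "(\<integral>\<^sup>+y. ennreal (exp (- (1/2) * (y \<bullet> y))) \<partial>(lborel :: (real^'p) measure))
     = ennreal (sqrt ((2 * pi) ^ CARD('p)))"
proof -
  have 1: "(\<integral>\<^sup>+t. ennreal (exp (- (1/2) * t\<^sup>2)) \<partial>(lborel :: real measure)) = ennreal (sqrt (2 * pi))"
  proof -
    have "(\<integral>\<^sup>+t. ennreal (exp (- (1/2) * t\<^sup>2)) \<partial>(lborel :: real measure))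
        = (\<integral>\<^sup>+t. ennreal (sqrt (2 * pi)) * ennreal (std_normal_density t) \<partial>lborel)"
      by (intro nn_integral_cong) (simp add: std_normal_density_def ennreal_mult'[symmetric])
    also have "\<dots> = ennreal (sqrt (2 * pi)) * (\<integral>\<^sup>+t. ennreal (std_normal_density t) \<partial>lborel)"
      by (simp add: nn_integral_cmult)
    also have "(\<integral>\<^sup>+t. ennreal (std_normal_density t) \<partial>lborel) = 1"
      by (subst nn_integral_eq_integral) auto
    finally show ?thesis by simp
  qed
  have "ennreal (exp (- (1/2) * (y \<bullet> y))) = (\<Prod>b\<in>Basis. ennreal (exp (- (1/2) * (y \<bullet> b)\<^sup>2)))" for y :: "real^'p"
    by (subst euclidean_inner)
      (simp add: prod_ennreal exp_sum[symmetric] sum_distrib_left sum_negf power2_eq_square)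
  then have "(\<integral>\<^sup>+y. ennreal (exp (- (1/2) * (y \<bullet> y))) \<partial>(lborel :: (real^'p) measure))
      = (\<integral>\<^sup>+y. (\<Prod>b\<in>Basis. ennreal (exp (- (1/2) * (y \<bullet> b)\<^sup>2))) \<partial>(lborel :: (real^'p) measure))"
    by (intro nn_integral_cong)
  also have "\<dots> = (\<Prod>b\<in>(Basis :: (real^'p) set). (\<integral>\<^sup>+t. ennreal (exp (- (1/2) * t\<^sup>2)) \<partial>lborel))"
    by (rule nn_integral_lborel_prod) auto
  also have "\<dots> = ennreal (sqrt ((2 * pi) ^ CARD('p)))"
    unfolding 1 by (simp add: ennreal_power real_sqrt_power real_sqrt_mult power_mult_distrib)
  finally show ?thesis .
qed

text \<open>The substitution x = B y with \<open>B\<close> orthonormal for \<open>W\<close> turns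
  the form into the squared norm, and its Jacobian satisfies (det B)^2 * det W = 1. Both claims are
  read off the same \<open>B\<close>.\<close>

lemma pos_def_mat_det_pos_gaussian:
  fixes W :: "real^'p^'p"
  assumes W: "pos_def_mat W"
  shows pos_def_mat_det_pos: "0 < det W"
    and nn_integral_gaussian: "(\<integral>\<^sup>+x. ennreal (exp (- (1/2) * (x \<bullet> (W *v x)))) \<partial>lborel)
           = ennreal (sqrt ((2 * pi) ^ CARD('p) / det W))"
proof -
  obtain B :: "real^'p^'p" where B: "transpose B ** W ** B = mat 1" using pos_def_mat_orthonormal[OF W] by blast
  have "det B * det W * det B = 1"
    using arg_cong[OF B, of det] by (simp add: det_mul)
  then have d: "(det B)\<^sup>2 * det W = 1" by (simp add: power2_eq_square mult_ac)
  then have B0: "det B \<noteq> 0" by auto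
  show dW: "0 < det W"
    using zero_less_mult_pos[of "(det B)\<^sup>2" "det W"] d B0 by simp
  have dB: "\<bar>det B\<bar> = sqrt (1 / det W)"
    using d dW by (intro real_sqrt_unique[symmetric]) (auto simp: field_simps)
  have quad: "(B *v y) \<bullet> (W *v (B *v y)) = y \<bullet> y" for y
  proof -
    have "(B *v y) \<bullet> (W *v (B *v y)) = y \<bullet> ((transpose B ** W ** B) *v y)"
      by (metis dot_lmul_matrix matrix_vector_mul_assoc transpose_matrix_vector transpose_transpose)
    then show ?thesis by (simp add: B)
  qed
  have [measurable]: "(\<lambda>x. x \<bullet> (W *v x)) \<in> borel_measurable borel"
    by (intro borel_measurable_inner) auto
  have "(\<integral>\<^sup>+x. ennreal (exp (- (1/2) * (x \<bullet> (W *v x)))) \<partial>lborel)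
      = ennreal \<bar>det B\<bar> * (\<integral>\<^sup>+y. ennreal (exp (- (1/2) * (y \<bullet> y))) \<partial>(lborel :: (real^'p) measure))"
    by (subst nn_integral_lborel_linear[OF _ B0]) (simp_all add: quad)
  also have "\<dots> = ennreal (sqrt ((2 * pi) ^ CARD('p) / det W))"
    unfolding nn_integral_std_gaussian dB
    using dW by (subst ennreal_mult'[symmetric]) (simp_all add: real_sqrt_mult[symmetric])
  finally show "(\<integral>\<^sup>+x. ennreal (exp (- (1/2) * (x \<bullet> (W *v x)))) \<partial>lborel)
           = ennreal (sqrt ((2 * pi) ^ CARD('p) / det W))" .
qed

lemma borel_measurable_quadratic_form [measurable (raw)]:
  fixes f :: "'a \<Rightarrow> real^'p"
  assumes "f \<in> borel_measurable M"
  shows "(\<lambda>x. f x \<bullet> (W *v f x)) \<in> borel_measurable M"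
  by (intro borel_measurable_inner assms measurable_compose[OF assms measurable_matrix_vector_mult])

lemma has_bochner_integral_gaussian:
  fixes W :: "real^'p^'p"
  assumes W: "pos_def_mat W"
  shows "has_bochner_integral lborel (\<lambda>x. exp (- (1/2) * ((x - \<mu>) \<bullet> (W *v (x - \<mu>)))))
           (sqrt ((2 * pi) ^ CARD('p) / det W))"
proof (rule has_bochner_integral_nn_integral)
  have "(\<integral>\<^sup>+x. ennreal (exp (- (1/2) * ((x + - \<mu>) \<bullet> (W *v (x + - \<mu>))))) \<partial>lborel)
      = (\<integral>\<^sup>+x. ennreal (exp (- (1/2) * (x \<bullet> (W *v x)))) \<partial>lborel)"
    by (rule nn_integral_lborel_translate) measurable
  then show "(\<integral>\<^sup>+x. ennreal (exp (- (1/2) * ((x - \<mu>) \<bullet> (W *v (x - \<mu>))))) \<partial>lborel)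
      = ennreal (sqrt ((2 * pi) ^ CARD('p) / det W))"
    using nn_integral_gaussian[OF W] by simp
qed (use pos_def_mat_det_pos[OF W] in auto)

section \<open>Normal densities in terms of the precision matrix\<close>

lemma pos_def_mat_inverse:
  fixes W :: "real^'p^'p"
  assumes W: "pos_def_mat W"
  shows "matrix_inv (matrix_inv W) = W" "det (matrix_inv W) = 1 / det W"
    "c \<noteq> 0 \<Longrightarrow> (1 / c) *\<^sub>R matrix_inv W = matrix_inv (c *\<^sub>R W)"
proof -
  \<comment> \<open>\<open>matrix_inv\<close> is a Hilbert choice, so every concrete inverse is
    identified through uniqueness.\<close>
  have uniq: "matrix_inv A = B" if "A ** B = mat 1" for A B :: "real^'p^'p"
  proof -
    have "B ** A = mat 1" by (rule matrix_left_right_inverse[THEN iffD1, OF that])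
    with that have "\<exists>A'. A ** A' = mat 1 \<and> A' ** A = mat 1" by blast
    then have "A ** matrix_inv A = mat 1 \<and> matrix_inv A ** A = mat 1"
      unfolding matrix_inv_def by (rule someI_ex)
    then have "B = B ** (A ** matrix_inv A)" by simp
    also have "\<dots> = matrix_inv A" by (simp add: matrix_mul_assoc \<open>B ** A = mat 1\<close>)
    finally show ?thesis ..
  qed
  have "invertible W" using pos_def_mat_det_pos[OF W] by (simp add: invertible_det_nz)
  then obtain B where B: "W ** B = mat 1" "B ** W = mat 1" unfolding invertible_def by blast
  then have inv: "matrix_inv W = B" by (simp add: uniq)
  show "matrix_inv (matrix_inv W) = W" unfolding inv by (rule uniq) fact
  have "det W * det B = 1" using arg_cong[OF B(1), of det] by (simp add: det_mul)
  then show "det (matrix_inv W) = 1 / det W"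
    unfolding inv using pos_def_mat_det_pos[OF W] by (simp add: field_simps)
  show "(1 / c) *\<^sub>R matrix_inv W = matrix_inv (c *\<^sub>R W)" if "c \<noteq> 0"
    unfolding inv using that B by (subst uniq[of "c *\<^sub>R W" "(1 / c) *\<^sub>R B"]) (simp_all add: matrix_scalar_ac)
qed

lemma normal_density_precision:
  fixes W :: "real^'p^'p"
  assumes W: "pos_def_mat W"
  shows "normal_density \<mu> (matrix_inv W) \<theta> =
     exp (- (1/2) * ((\<theta> - \<mu>) \<bullet> (W *v (\<theta> - \<mu>)))) / sqrt ((2 * pi) ^ CARD('p) / det W)"
  by (simp add: normal_density_def pos_def_mat_inverse(1,2)[OF W])

lemma has_bochner_integral_normal_density:
  fixes W :: "real^'p^'p"
  assumes W: "pos_def_mat W"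
  shows "has_bochner_integral lborel (normal_density \<mu> (matrix_inv W)) 1"
proof -
  have "sqrt ((2 * pi) ^ CARD('p) / det W) \<noteq> 0"
    using pos_def_mat_det_pos[OF W] by (simp add: field_simps)
  moreover have "normal_density \<mu> (matrix_inv W) = (\<lambda>\<theta>.
     exp (- (1/2) * ((\<theta> - \<mu>) \<bullet> (W *v (\<theta> - \<mu>)))) / sqrt ((2 * pi) ^ CARD('p) / det W))"
    by (intro ext normal_density_precision W)
  ultimately show ?thesis
    using has_bochner_integral_divide_zero[OF has_bochner_integral_gaussian[OF W, of \<mu>], of "sqrt ((2 * pi) ^ CARD('p) / det W)"]
    by (simp only: divide_self if_False not_False_eq_True)
qed

text \<open>\<open>m\<close> is the minimum of the form on the compact unit sphere, extended by
  homogeneity; \<open>L\<close> is an operator bound combined with Cauchy-Schwarz.\<close>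

lemma pos_def_mat_bounds:
  fixes V :: "real^'p^'p"
  assumes V: "pos_def_mat V"
  obtains m L where "0 < m" "\<And>x. m * (norm x)\<^sup>2 \<le> x \<bullet> (V *v x)"
    "0 < L" "\<And>x y. \<bar>x \<bullet> (V *v y)\<bar> \<le> L * norm x * norm y"
proof -
  obtain L where L: "0 < L" "\<And>y. norm (V *v y) \<le> norm y * L"
    using bounded_linear.pos_bounded[OF matrix_vector_mul_bounded_linear[of V]] by blast
  have "continuous_on (sphere 0 1) (\<lambda>x. x \<bullet> (V *v x))"
    by (intro continuous_on_inner continuous_on_id matrix_vector_mult_linear_continuous_on)
  moreover have "axis undefined 1 \<in> sphere (0 :: real^'p) 1" by simp
  ultimately obtain e where "e \<in> sphere 0 1" "\<forall>x\<in>sphere 0 1. e \<bullet> (V *v e) \<le> x \<bullet> (V *v x)"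
    using continuous_attains_inf[OF compact_sphere, of "0 :: real^'p" 1 "\<lambda>x. x \<bullet> (V *v x)"] by blast
  then have e: "norm e = 1" "\<And>x. norm x = 1 \<Longrightarrow> e \<bullet> (V *v e) \<le> x \<bullet> (V *v x)"
    by simp_all
  show ?thesis
  proof
    have "e \<noteq> 0" using e(1) by auto
    then show "0 < e \<bullet> (V *v e)" using V by (simp add: pos_def_mat_def)
    show "(e \<bullet> (V *v e)) * (norm x)\<^sup>2 \<le> x \<bullet> (V *v x)" for x
    proof (cases "x = 0")
      case False
      have "e \<bullet> (V *v e) \<le> (x /\<^sub>R norm x) \<bullet> (V *v (x /\<^sub>R norm x))"
        by (rule e(2)) (use False in simp)
      also have "\<dots> = (x \<bullet> (V *v x)) / (norm x)\<^sup>2"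
        by (simp add: matrix_vector_mult_scaleR power2_eq_square field_simps)
      finally show ?thesis using False by (simp add: field_simps)
    qed simp
    show "\<bar>x \<bullet> (V *v y)\<bar> \<le> L * norm x * norm y" for x y
      using order_trans[OF Cauchy_Schwarz_ineq2 mult_left_mono[OF L(2)[of y], of "norm x"]]
      by (simp add: mult_ac)
  qed (fact L(1))
qed

lemma det_scaleR: "det (c *\<^sub>R A) = c ^ CARD('p) * det (A :: real^'p^'p)"
  using det_rows_mul[of "\<lambda>_. c" "\<lambda>i. A $ i"]
  by (simp add: scalar_mult_eq_scaleR scaleR_vec_def)

text \<open>A Chernoff bound: the exponential moment of the quadratic form is again a Gaussian
  integral, with precision matrix \<open>W / 2\<close>.\<close>
lemma normal_density_tail:
  fixes W :: "real^'p^'p"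
  assumes W: "pos_def_mat W" and S: "S \<in> sets borel"
    and t: "\<And>\<theta>. \<theta> \<in> S \<Longrightarrow> t \<le> (\<theta> - \<mu>) \<bullet> (W *v (\<theta> - \<mu>))"
  shows "(LINT \<theta>|lborel. indicator S \<theta> * normal_density \<mu> (matrix_inv W) \<theta>) \<le> exp (- t / 4) * sqrt (2 ^ CARD('p))"
proof -
  let ?c = "sqrt ((2 * pi) ^ CARD('p) / det W)"
  let ?q = "\<lambda>W \<theta>. (\<theta> - \<mu>) \<bullet> (W *v (\<theta> - \<mu>))"
  have dW: "0 < det W" by (rule pos_def_mat_det_pos[OF W])
  then have c: "0 < ?c" by simp
  have W2: "pos_def_mat ((1/2) *\<^sub>R W)" by (rule pos_def_mat_scaleR[OF W]) simp
  \<comment> \<open>Halving the precision divides the determinant by 2^p; this is the origin of the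
    factor \<open>sqrt (2 ^ CARD('p))\<close>.\<close>
  have "sqrt ((2 * pi) ^ CARD('p) / det ((1/2) *\<^sub>R W)) = ?c * sqrt (2 ^ CARD('p))"
    by (simp only: real_sqrt_mult[symmetric] det_scaleR) (simp add: field_simps)
  moreover have "(c * k) * (e / c) = e * k" if "0 < c" for c k e :: real using that by simp
  ultimately have "sqrt ((2 * pi) ^ CARD('p) / det ((1/2) *\<^sub>R W)) * (exp (- t / 4) / ?c) = exp (- t / 4) * sqrt (2 ^ CARD('p))"
    using c by presburger
  then have I: "has_bochner_integral lborel (\<lambda>\<theta>. exp (- (1/2) * ?q ((1/2) *\<^sub>R W) \<theta>) * (exp (- t / 4) / ?c))
      (exp (- t / 4) * sqrt (2 ^ CARD('p)))"
    using has_bochner_integral_mult_left[OF has_bochner_integral_gaussian[OF W2, of \<mu>], of "exp (- t / 4) / ?c"] by (simp only:)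
  have "(LINT \<theta>|lborel. indicator S \<theta> * normal_density \<mu> (matrix_inv W) \<theta>)
      \<le> (LINT \<theta>|lborel. exp (- (1/2) * ?q ((1/2) *\<^sub>R W) \<theta>) * (exp (- t / 4) / ?c))"
  proof (rule integral_mono)
    show "integrable lborel (\<lambda>\<theta>. indicator S \<theta> * normal_density \<mu> (matrix_inv W) \<theta>)"
      using integrable_mult_indicator[OF _ integrable.intros[OF has_bochner_integral_normal_density[OF W]], of S \<mu>] S
      by simp
    show "integrable lborel (\<lambda>\<theta>. exp (- (1/2) * ?q ((1/2) *\<^sub>R W) \<theta>) * (exp (- t / 4) / ?c))"
      using I by (rule integrable.intros)
    fix \<theta>
    show "indicator S \<theta> * normal_density \<mu> (matrix_inv W) \<theta> \<le> exp (- (1/2) * ?q ((1/2) *\<^sub>R W) \<theta>) * (exp (- t / 4) / ?c)"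
    proof (cases "\<theta> \<in> S")
      case True
      \<comment> \<open>Half of the exponent is kept as a Gaussian of precision
        \<open>W / 2\<close>; the other half is at most \<open>- t / 4\<close> on
        \<open>S\<close>.\<close>
      have "- (1/2) * ?q W \<theta> \<le> - (1/2) * ?q ((1/2) *\<^sub>R W) \<theta> + - t / 4"
        using t[OF True] by (simp add: scaleR_matrix_vector_assoc[symmetric])
      then have "exp (- (1/2) * ?q W \<theta>) \<le> exp (- (1/2) * ?q ((1/2) *\<^sub>R W) \<theta>) * exp (- t / 4)"
        by (simp only: exp_add[symmetric] exp_le_cancel_iff)
      then show ?thesis
        using True divide_right_mono[OF _ less_imp_le[OF c]] by (simp only: normal_density_precision[OF W] indicator_simps times_divide_eq_right mult_1) 
    qed (use c in simp)
  qed
  also have "\<dots> = exp (- t / 4) * sqrt (2 ^ CARD('p))"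
    using I by (rule has_bochner_integral_integral_eq)
  finally show ?thesis .
qed

section \<open>Total variation and shifts\<close>

lemma integral_indicator_compl:
  assumes "has_bochner_integral M f I" "B \<in> sets M" "space M = UNIV"
  shows "(LINT x|M. indicator (- B) x * f x) = I - (LINT x|M. indicator B x * (f x :: real))"
proof -
  have f: "integrable M f" using assms(1) by (rule integrable.intros)
  have i: "integrable M (\<lambda>x. indicator A x * f x)" if "A \<in> sets M" for A
    using integrable_mult_indicator[OF that f] by simp
  have "- B \<in> sets M" using assms(2,3) by (metis Compl_eq_Diff_UNIV sets.compl_sets)
  then have "(LINT x|M. indicator (- B) x * f x) + (LINT x|M. indicator B x * f x)
      = (LINT x|M. indicator (- B) x * f x + indicator B x * f x)"
    using i assms(2) by (intro Bochner_Integration.integral_add[symmetric]) auto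
  also have "\<dots> = (LINT x|M. f x)" by (intro Bochner_Integration.integral_cong) (auto simp: indicator_def)
  also have "\<dots> = I" using assms(1) by (rule has_bochner_integral_integral_eq)
  finally show ?thesis by simp
qed

text \<open>The unknown factor \<open>Z\<close> is pinned by the masses. Both integrals over
  \<open>B\<close> lie between 1 - \<epsilon> and 1, so integrating the two pointwise bounds gives
  (1 - \<epsilon>) exp (- \<delta>) \<le> Z \<le> exp \<delta> / (1 - \<epsilon>). Hence f / g stays
  between 1 / \<kappa> and \<kappa> on \<open>B\<close> with \<kappa> = exp (2 \<delta>) / (1 -
  \<epsilon>), and the complement costs \<epsilon> for each density.\<close>

lemma L1_dist_le:
  fixes f g :: "'a \<Rightarrow> real"
  assumes f: "has_bochner_integral M f 1" and g: "has_bochner_integral M g 1"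
    and f0: "\<And>x. 0 \<le> f x" and g0: "\<And>x. 0 \<le> g x"
    and B: "B \<in> sets M" and M: "space M = UNIV"
    and lo: "\<And>x. x \<in> B \<Longrightarrow> exp (- \<delta>) * Z * g x \<le> f x"
    and up: "\<And>x. x \<in> B \<Longrightarrow> f x \<le> exp \<delta> * Z * g x"
    and Z: "0 < Z" and \<epsilon>: "\<epsilon> < 1"
    and fB: "(LINT x|M. indicator (- B) x * f x) \<le> \<epsilon>" and gB: "(LINT x|M. indicator (- B) x * g x) \<le> \<epsilon>"
  shows "(LINT x|M. \<bar>f x - g x\<bar>) \<le> 2 * \<epsilon> + (exp (2 * \<delta>) / (1 - \<epsilon>) - 1)"
proof -
  have fi: "integrable M f" and gi: "integrable M g" using f g by (auto intro: integrable.intros)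
  have Bc: "- B \<in> sets M" using B M by (metis Compl_eq_Diff_UNIV sets.compl_sets)
  have ind: "integrable M (\<lambda>x. indicator A x * h x)" if "A \<in> sets M" "integrable M h" for A and h :: "'a \<Rightarrow> real"
    using integrable_mult_indicator[OF that] by simp
  let ?F = "LINT x|M. indicator B x * f x" and ?G = "LINT x|M. indicator B x * g x"
  define \<kappa> where "\<kappa> = exp (2 * \<delta>) / (1 - \<epsilon>)"
  have \<kappa>: "0 < \<kappa>" using \<epsilon> by (simp add: \<kappa>_def)
  have F: "1 - \<epsilon> \<le> ?F" and G: "1 - \<epsilon> \<le> ?G"
    using fB gB integral_indicator_compl[OF f B M] integral_indicator_compl[OF g B M] by auto
  have F1: "?F \<le> 1" and G1: "?G \<le> 1"
    using integral_indicator_compl[OF f B M] integral_indicator_compl[OF g B M]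
      Bochner_Integration.integral_nonneg[of M "\<lambda>x. indicator (- B) x * f x"]
      Bochner_Integration.integral_nonneg[of M "\<lambda>x. indicator (- B) x * g x"] f0 g0
    by auto
  have "?F \<le> (LINT x|M. (exp \<delta> * Z) * (indicator B x * g x))"
    using up by (intro integral_mono ind B fi gi integrable_mult_right) (auto simp: indicator_def)
  then have FG: "?F \<le> exp \<delta> * Z * ?G" by simp
  have "(LINT x|M. (exp (- \<delta>) * Z) * (indicator B x * g x)) \<le> ?F"
    using lo by (intro integral_mono ind B fi gi integrable_mult_right) (auto simp: indicator_def)
  then have GF: "exp (- \<delta>) * Z * ?G \<le> ?F" by simp
  have Zlo: "1 - \<epsilon> \<le> exp \<delta> * Z"
  proof -
    have "exp \<delta> * Z * ?G \<le> exp \<delta> * Z" using G1 Z by simp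
    then show ?thesis using F FG by linarith
  qed
  have Zup: "exp (- \<delta>) * Z * (1 - \<epsilon>) \<le> 1"
  proof -
    have "exp (- \<delta>) * Z * (1 - \<epsilon>) \<le> exp (- \<delta>) * Z * ?G" using G Z by simp
    then show ?thesis using F1 GF by linarith
  qed
  have "exp \<delta> * Z \<le> \<kappa>"
  proof -
    have "Z \<le> exp \<delta> / (1 - \<epsilon>)" using Zup \<epsilon> by (simp add: field_simps exp_minus)
    then have "exp \<delta> * Z \<le> exp \<delta> * (exp \<delta> / (1 - \<epsilon>))" by (rule mult_left_mono) simp
    then show ?thesis by (simp add: \<kappa>_def exp_double power2_eq_square)
  qed
  then have fup: "f x \<le> \<kappa> * g x" if "x \<in> B" for x
    using up[OF that] mult_right_mono[OF _ g0[of x]] by (meson order_trans)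
  have "1 / \<kappa> \<le> exp (- \<delta>) * Z"
  proof -
    have "(1 - \<epsilon>) / exp \<delta> \<le> Z" using Zlo by (simp add: field_simps)
    then have "(1 - \<epsilon>) / exp \<delta> / exp \<delta> \<le> Z / exp \<delta>" by (intro divide_right_mono) auto
    moreover have "1 / \<kappa> = (1 - \<epsilon>) / exp \<delta> / exp \<delta>"
      by (simp add: \<kappa>_def exp_double power2_eq_square)
    moreover have "exp (- \<delta>) * Z = Z / exp \<delta>" by (simp add: exp_minus field_simps)
    ultimately show ?thesis by simp
  qed
  \<comment> \<open>This is (\<kappa> - 1)^2 \<ge> 0 divided by \<kappa>; it makes the lower bound
    on f as linear as the upper one, so that |f - g| \<le> (\<kappa> - 1) g on
    \<open>B\<close>.\<close>
  moreover have "2 - \<kappa> \<le> 1 / \<kappa>"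
    using \<kappa> sum_squares_ge_zero[of "\<kappa> - 1" 0] by (simp add: field_simps)
  ultimately have flo: "(2 - \<kappa>) * g x \<le> f x" if "x \<in> B" for x
    using lo[OF that] mult_right_mono[of "2 - \<kappa>" "exp (- \<delta>) * Z", OF _ g0[of x]] by linarith
  \<comment> \<open>No sign of \<delta> is assumed, so \<kappa> \<ge> 1 is derived from the two
    bounds at a point of \<open>B\<close> where g is positive. Such a point exists, because g has
    positive mass on \<open>B\<close>.\<close>
  have "\<kappa> \<ge> 1 \<or> (\<forall>x\<in>B. g x = 0)"
  proof (rule disjCI)
    assume "\<not> (\<forall>x\<in>B. g x = 0)"
    then obtain x where x: "x \<in> B" "0 < g x" using g0 by (metis less_eq_real_def)
    have "(2 - \<kappa>) * g x \<le> \<kappa> * g x" using flo fup x by (meson order_trans)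
    then show "\<kappa> \<ge> 1" using x by simp
  qed
  have pt: "\<bar>f x - g x\<bar> \<le> (\<kappa> - 1) * (indicator B x * g x) + (indicator (- B) x * f x + indicator (- B) x * g x)" for x
    using fup[of x] flo[of x] f0[of x] g0[of x] by (cases "x \<in> B") (auto simp: algebra_simps)
  have "(LINT x|M. \<bar>f x - g x\<bar>) \<le> (LINT x|M. (\<kappa> - 1) * (indicator B x * g x) + (indicator (- B) x * f x + indicator (- B) x * g x))"
    using fi gi pt by (intro integral_mono) (auto intro!: ind B Bc)
  also have "\<dots> = (\<kappa> - 1) * ?G + ((LINT x|M. indicator (- B) x * f x) + (LINT x|M. indicator (- B) x * g x))"
    using ind[OF B gi] ind[OF Bc fi] ind[OF Bc gi] by simp
  also have "\<dots> \<le> (\<kappa> - 1) + (\<epsilon> + \<epsilon>)"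
  proof -
    have "(\<kappa> - 1) * ?G \<le> \<kappa> - 1"
    proof -
      have "?G > 0" using G \<epsilon> by linarith
      have "?G = 0" if "\<forall>x\<in>B. g x = 0"
      proof -
        have "?G = (LINT x|M. 0)" using that by (intro Bochner_Integration.integral_cong) (auto simp: indicator_def)
        then show ?thesis by simp
      qed
      with \<open>?G > 0\<close> \<open>\<kappa> \<ge> 1 \<or> (\<forall>x\<in>B. g x = 0)\<close> have "\<kappa> \<ge> 1" by auto
      then show ?thesis using G1 mult_left_mono[OF G1, of "\<kappa> - 1"] by simp
    qed
    then show ?thesis using fB gB by linarith
  qed
  finally show ?thesis by (simp add: \<kappa>_def)
qed

section \<open>Comparing the mass of a ball with that of a translate\<close>

lemma lborel_integral_translate:
  fixes f :: "'a::euclidean_space \<Rightarrow> real"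
  assumes "integrable lborel f"
  shows "integrable lborel (\<lambda>x. f (x + v))" "(LINT x|lborel. f (x + v)) = (LINT x|lborel. f x)"
proof -
  have m: "(+) v \<in> lborel \<rightarrow>\<^sub>M borel" by simp
  have f: "f \<in> borel_measurable borel" using assms by auto
  show "integrable lborel (\<lambda>x. f (x + v))"
    using integrable_distr_eq[OF m f] assms by (simp add: lborel_distr_plus add.commute)
  show "(LINT x|lborel. f (x + v)) = (LINT x|lborel. f x)"
    using integral_distr[OF m f] by (simp add: lborel_distr_plus add.commute)
qed

text \<open>The translate of \<open>B\<close> by \<open>v\<close> lies in the complement of
  \<open>B\<close>, and by translation invariance it carries at least \<open>c\<close> times the
  mass of \<open>B\<close>.\<close>

lemma mass_le_by_shift:
  fixes f :: "'a::euclidean_space \<Rightarrow> real"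
  assumes f: "integrable lborel f" and f0: "\<And>x. 0 \<le> f x" and B: "B \<in> sets borel"
    and shift: "\<And>x. x \<in> B \<Longrightarrow> x + v \<notin> B \<and> c * f x \<le> f (x + v)"
  shows "c * (LINT x|lborel. indicator B x * f x) \<le> (LINT x|lborel. indicator (- B) x * f x)"
proof -
  have ind: "integrable lborel (\<lambda>x. indicator A x * f x)" if "A \<in> sets borel" for A
    using integrable_mult_indicator[OF _ f, of A] that by simp
  have Bc: "- B \<in> sets borel" using B by (rule borel_comp)
  have "c * (LINT x|lborel. indicator B x * f x) = (LINT x|lborel. c * (indicator B x * f x))" by simp
  also have "\<dots> \<le> (LINT x|lborel. indicator (- B) (x + v) * f (x + v))"
  proof (rule integral_mono)
    show "integrable lborel (\<lambda>x. c * (indicator B x * f x))" using ind[OF B] by simp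
    show "integrable lborel (\<lambda>x. indicator (- B) (x + v) * f (x + v))"
      by (rule lborel_integral_translate(1)[OF ind[OF Bc]])
  qed (use shift f0 in \<open>auto simp: indicator_def\<close>)
  also have "\<dots> = (LINT x|lborel. indicator (- B) x * f x)"
    by (rule lborel_integral_translate(2)[OF ind[OF Bc]])
  finally show ?thesis .
qed

text \<open>If \<open>f\<close> puts almost all its mass on a ball and is nearly proportional to a Gaussian on
  the ball of four times the radius, then moving the ball towards the mode must lose mass,
  which bounds the Gaussian's scale from below and the offset of its mode from above.\<close>
lemma gaussian_parameters_bounded:
  fixes V :: "real^'p^'p" and f :: "real^'p \<Rightarrow> real"
  defines "q \<equiv> \<lambda>x. x \<bullet> (V *v x)"
  assumes V: "pos_def_mat V"
    and m: "0 < m" "\<And>x. m * (norm x)\<^sup>2 \<le> x \<bullet> (V *v x)"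
    and L: "0 < L" "\<And>x y. \<bar>x \<bullet> (V *v y)\<bar> \<le> L * norm x * norm y"
    and pos: "0 < R" "0 < a" "0 < s" "0 < Z" and \<epsilon>: "\<epsilon> \<le> 1/20"
    and f0: "\<And>\<theta>. 0 \<le> f \<theta>" and f: "has_bochner_integral lborel f 1"
    and mass: "(LINT \<theta>|lborel. indicator (- cball \<theta>s (R / s)) \<theta> * f \<theta>) \<le> \<epsilon>"
    and lo: "\<And>\<theta>. \<theta> \<in> cball \<theta>s (4 * R / s) \<Longrightarrow> exp (- \<epsilon>) * Z * exp (- (1/2) * (a * s\<^sup>2 * q (\<theta> - \<theta>h))) \<le> f \<theta>"
    and up: "\<And>\<theta>. \<theta> \<in> cball \<theta>s (4 * R / s) \<Longrightarrow> f \<theta> \<le> exp \<epsilon> * Z * exp (- (1/2) * (a * s\<^sup>2 * q (\<theta> - \<theta>h)))"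
  shows "2 / (15 * L * R\<^sup>2) \<le> a" "s * norm (\<theta>h - \<theta>s) \<le> 5 * L * R / (2 * m)"
proof -
  let ?B = "cball \<theta>s (R / s)"
  define d where "d = \<theta>h - \<theta>s"
  \<comment> \<open>The direction from the centre to the mode. If the two coincide, any unit vector
    serves.\<close>
  obtain e where e: "norm e = 1" "d = norm d *\<^sub>R e"
  proof (cases "d = 0")
    case True
    have "norm (axis undefined 1 :: real^'p) = 1" by simp
    with True that show ?thesis by (metis norm_zero scaleR_zero_left)
  next
    case False
    then show ?thesis by (intro that[of "d /\<^sub>R norm d"]) auto
  qed
  \<comment> \<open>The length 3R/s exceeds the diameter 2R/s, so the translated ball is disjoint
    from the original, and it stays within radius 4R/s, where f is controlled.\<close>
  define v where "v = (3 * R / s) *\<^sub>R e"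
  have nv: "norm v = 3 * R / s" using e pos by (simp add: v_def)
  have Bsub: "?B \<subseteq> cball \<theta>s (4 * R / s)" using pos by (intro subset_cball divide_right_mono) auto
  have Bv: "x + v \<in> cball \<theta>s (4 * R / s)" "x + v \<notin> ?B" if "x \<in> ?B" for x
  proof -
    have x: "norm (x - \<theta>s) \<le> R / s" using that by (simp add: dist_norm norm_minus_commute)
    have "norm (x + v - \<theta>s) \<le> norm (x - \<theta>s) + norm v"
      using norm_triangle_ineq[of "x - \<theta>s" v] by (simp add: algebra_simps)
    also have "\<dots> \<le> 4 * R / s" using x nv pos by (simp add: field_simps)
    finally show "x + v \<in> cball \<theta>s (4 * R / s)" by (simp add: dist_norm norm_minus_commute)
    have "norm v \<le> norm (x + v - \<theta>s) + norm (x - \<theta>s)"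
      using norm_triangle_ineq4[of "x + v - \<theta>s" "x - \<theta>s"] by (simp add: algebra_simps)
    then have "2 * (R / s) \<le> norm (x + v - \<theta>s)" using x nv by simp
    moreover have "0 < R / s" using pos by simp
    ultimately have "R / s < norm (x + v - \<theta>s)" by linarith
    then show "x + v \<notin> ?B" by (simp add: dist_norm norm_minus_commute)
  qed
  have e9: "1 / 9 \<le> exp (- 2 :: real)"
  proof -
    have "exp (2::real) = exp 1 * exp 1" by (simp add: exp_add[symmetric])
    also have "\<dots> \<le> 3 * 3" using exp_le by (intro mult_mono) auto
    finally show ?thesis by (simp add: exp_minus field_simps)
  qed
  \<comment> \<open>Otherwise the complement of the ball would have mass at least 1/9 * 19/20 =
    19/180, more than the 1/20 allowed there.\<close>
  have "\<exists>x\<in>?B. f (x + v) < exp (- 2) * f x"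
  proof (rule ccontr)
    assume "\<not> ?thesis"
    then have "exp (- 2) * (LINT x|lborel. indicator ?B x * f x) \<le> (LINT x|lborel. indicator (- ?B) x * f x)"
      by (intro mass_le_by_shift[of f ?B v] f0 integrable.intros[OF f]) (use Bv in \<open>auto simp: not_less\<close>)
    moreover have "19 / 20 \<le> (LINT x|lborel. indicator ?B x * f x)"
      using mass \<epsilon> integral_indicator_compl[OF f, of ?B] by simp
    moreover from this have "1 / 9 * (19 / 20) \<le> exp (- 2) * (LINT x|lborel. indicator ?B x * f x)"
      using e9 by (intro mult_mono) auto
    ultimately show False using mass \<epsilon> by simp
  qed
  then obtain x where x: "x \<in> ?B" "f (x + v) < exp (- 2) * f x" by blast
  define y where "y = x - \<theta>s"
  have y: "norm y \<le> R / s" using x by (simp add: y_def dist_norm norm_minus_commute)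
  have "exp (- \<epsilon>) * Z * exp (- (1/2) * (a * s\<^sup>2 * q (x + v - \<theta>h))) < exp (- 2) * (exp \<epsilon> * Z * exp (- (1/2) * (a * s\<^sup>2 * q (x - \<theta>h))))"
  proof -
    have "exp (- 2) * f x \<le> exp (- 2) * (exp \<epsilon> * Z * exp (- (1/2) * (a * s\<^sup>2 * q (x - \<theta>h))))"
      using x(1) Bsub by (intro mult_left_mono up) auto
    with lo[OF Bv(1)[OF x(1)]] x(2) show ?thesis by linarith
  qed
  then have "Z * exp (- \<epsilon> + - (1/2) * (a * s\<^sup>2 * q (x + v - \<theta>h))) < Z * exp (- 2 + (\<epsilon> + - (1/2) * (a * s\<^sup>2 * q (x - \<theta>h))))"
    unfolding exp_add by (simp add: mult_ac)
  then have "- \<epsilon> + - (1/2) * (a * s\<^sup>2 * q (x + v - \<theta>h)) < - 2 + (\<epsilon> + - (1/2) * (a * s\<^sup>2 * q (x - \<theta>h)))"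
    using pos by simp
  \<comment> \<open>The drop of the logarithm exceeds 2 - 2\<epsilon> \<ge> 19/10; the bound 1 keeps
    the constants simple.\<close>
  then have "1 < (1/2) * (a * s\<^sup>2 * (q (x + v - \<theta>h) - q (x - \<theta>h)))"
    using \<epsilon> by (simp add: algebra_simps)
  also have "q (x + v - \<theta>h) - q (x - \<theta>h) = 2 * (y \<bullet> (V *v v)) - 2 * (d \<bullet> (V *v v)) + v \<bullet> (V *v v)"
  proof -
    have "x + v - \<theta>h = (y - d) + v" "x - \<theta>h = y - d" by (simp_all add: y_def d_def)
    moreover have "((y - d) + v) \<bullet> (V *v ((y - d) + v)) - (y - d) \<bullet> (V *v (y - d))
        = 2 * (y \<bullet> (V *v v)) - 2 * (d \<bullet> (V *v v)) + v \<bullet> (V *v v)"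
      using pos_def_mat_sym[OF V, of v y] pos_def_mat_sym[OF V, of v d]
      by (simp add: matrix_vector_right_distrib matrix_vector_mult_diff_distrib inner_add_left
          inner_add_right inner_diff_left inner_diff_right)
    ultimately show ?thesis by (simp only: q_def)
  qed
  also have "(1/2) * (a * s\<^sup>2 * (2 * (y \<bullet> (V *v v)) - 2 * (d \<bullet> (V *v v)) + v \<bullet> (V *v v)))
      \<le> (1/2) * (a * s\<^sup>2 * (2 * (3 * L * R\<^sup>2 / s\<^sup>2) - 2 * (3 * R * norm d * m / s) + 9 * L * R\<^sup>2 / s\<^sup>2))"
  proof -
    have "y \<bullet> (V *v v) \<le> L * norm y * norm v" using L(2)[of y v] by simp
    also have "\<dots> \<le> L * (R / s) * (3 * R / s)" using y L pos nv by (intro mult_mono) auto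
    finally have 1: "y \<bullet> (V *v v) \<le> 3 * L * R\<^sup>2 / s\<^sup>2" by (simp add: power2_eq_square mult_ac)
    have "v \<bullet> (V *v v) \<le> L * norm v * norm v" using L(2)[of v v] by simp
    then have 2: "v \<bullet> (V *v v) \<le> 9 * L * R\<^sup>2 / s\<^sup>2" by (simp add: nv power2_eq_square)
    \<comment> \<open>Since \<open>v\<close> is parallel to \<open>d\<close>, the mixed term has a
      favourable sign and is bounded below through \<open>m\<close>. It is the term that limits the
      offset of the mode.\<close>
    have "d \<bullet> (V *v v) = norm d * (3 * R / s) * (e \<bullet> (V *v e))"
      by (subst e(2)) (simp add: v_def matrix_vector_mult_scaleR)
    moreover have "norm d * (3 * R / s) * m \<le> norm d * (3 * R / s) * (e \<bullet> (V *v e))"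
      using m(2)[of e] e(1) pos by (intro mult_left_mono) auto
    ultimately have 3: "3 * R * norm d * m / s \<le> d \<bullet> (V *v v)" by (simp add: mult_ac)
    show ?thesis using 1 2 3 pos by (intro mult_left_mono) auto
  qed
  also have "\<dots> = (1/2) * (a * (15 * L * R\<^sup>2 - 6 * R * m * (s * norm d)))"
    using pos by (simp add: field_simps power2_eq_square)
  finally have main: "1 < (1/2) * (a * (15 * L * R\<^sup>2 - 6 * R * m * (s * norm d)))" .
  \<comment> \<open>\<open>main\<close> is read twice: positivity of the bracket bounds the offset
    \<open>s * norm d\<close>, and dropping the negative term of the bracket bounds \<open>a\<close>
    from below.\<close>
  have "0 < a * (15 * L * R\<^sup>2 - 6 * R * m * (s * norm d))" using main by simp
  then have "R * (6 * m * (s * norm d)) < R * (15 * L * R)"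
    using pos by (simp add: zero_less_mult_iff power2_eq_square mult_ac)
  then have "6 * m * (s * norm d) < 15 * L * R" using pos by simp
  then show "s * norm (\<theta>h - \<theta>s) \<le> 5 * L * R / (2 * m)"
    using m by (simp add: d_def field_simps)
  have "a * (15 * L * R\<^sup>2 - 6 * R * m * (s * norm d)) \<le> a * (15 * L * R\<^sup>2)"
    using pos m by (intro mult_left_mono) auto
  then have "2 < a * (15 * L * R\<^sup>2)" using main by simp
  then show "2 / (15 * L * R\<^sup>2) \<le> a" using L pos by (simp add: field_simps)
qed

text \<open>In units of 1/s, \<open>R\<close> is the radius that captures the mass of f and
  \<open>R'\<close> the radius on which its shape is known. Scale, centre, mode and proportionality
  factor are quantified inside, so both radii can be fixed before the sample size and the sample
  point. In the application \<open>s\<close> is \<open>sqrt (real n)\<close> and \<open>a\<close> is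
  \<open>alpha_bar \<alpha> n\<close>.\<close>

definition forces_gaussian :: "real^'p^'p \<Rightarrow> real \<Rightarrow> real \<Rightarrow> real \<Rightarrow> real \<Rightarrow> bool" where
  "forces_gaussian V \<epsilon> R R' \<eta> \<longleftrightarrow> (\<forall>a s \<theta>s \<theta>h Z f. 0 < a \<longrightarrow> 0 < s \<longrightarrow> 0 < Z \<longrightarrow> (\<forall>\<theta>. 0 \<le> f \<theta>) \<longrightarrow>
       has_bochner_integral lborel f 1 \<longrightarrow>
       (LINT \<theta>|lborel. indicator (- cball \<theta>s (R / s)) \<theta> * f \<theta>) \<le> \<epsilon> \<longrightarrow>
       (\<forall>\<theta>\<in>cball \<theta>s (R' / s).
          exp (- \<epsilon>) * Z * exp (- (1/2) * (a * s\<^sup>2 * ((\<theta> - \<theta>h) \<bullet> (V *v (\<theta> - \<theta>h))))) \<le> f \<theta> \<and>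
          f \<theta> \<le> exp \<epsilon> * Z * exp (- (1/2) * (a * s\<^sup>2 * ((\<theta> - \<theta>h) \<bullet> (V *v (\<theta> - \<theta>h)))))) \<longrightarrow>
       (LINT \<theta>|lborel. \<bar>f \<theta> - normal_density \<theta>h (matrix_inv ((a * s\<^sup>2) *\<^sub>R V)) \<theta>\<bar>) \<le> \<eta>)"

lemma forces_gaussianD:
  assumes "forces_gaussian V \<epsilon> R R' \<eta>" "0 < a" "0 < s" "0 < Z" "\<And>\<theta>. 0 \<le> f \<theta>"
    "has_bochner_integral lborel f 1"
    "(LINT \<theta>|lborel. indicator (- cball \<theta>s (R / s)) \<theta> * f \<theta>) \<le> \<epsilon>"
    "\<And>\<theta>. \<theta> \<in> cball \<theta>s (R' / s) \<Longrightarrow>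
       exp (- \<epsilon>) * Z * exp (- (1/2) * (a * s\<^sup>2 * ((\<theta> - \<theta>h) \<bullet> (V *v (\<theta> - \<theta>h))))) \<le> f \<theta> \<and>
       f \<theta> \<le> exp \<epsilon> * Z * exp (- (1/2) * (a * s\<^sup>2 * ((\<theta> - \<theta>h) \<bullet> (V *v (\<theta> - \<theta>h)))))"
  shows "(LINT \<theta>|lborel. \<bar>f \<theta> - normal_density \<theta>h (matrix_inv ((a * s\<^sup>2) *\<^sub>R V)) \<theta>\<bar>) \<le> \<eta>"
  using assms(1)[unfolded forces_gaussian_def] assms(2-) by simp

text \<open>The order of quantifiers is the point: \<epsilon> depends on \<eta> alone because
  \<open>R\<close> is obtained later, from concentration at level \<epsilon>, and \<open>R'\<close>
  must be known before n so that LAN is applied on a fixed compact ball.\<close>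

lemma gaussian_approximation:
  fixes V :: "real^'p^'p"
  assumes V: "pos_def_mat V" and \<eta>: "0 < \<eta>"
  shows "\<exists>\<epsilon>>0. \<forall>R>0. \<exists>R'>0. forces_gaussian V \<epsilon> R R' \<eta>"
proof -
  obtain m L where m: "0 < m" "\<And>x. m * (norm x)\<^sup>2 \<le> x \<bullet> (V *v x)"
    and L: "0 < L" "\<And>x y. \<bar>x \<bullet> (V *v y)\<bar> \<le> L * norm x * norm y"
    by (rule pos_def_mat_bounds[OF V]) (rule that)
  \<comment> \<open>The expression is the bound of \<open>L1_dist_le\<close> with \<delta> =
    \<epsilon>; the threshold 1/20 below is the one of
    \<open>gaussian_parameters_bounded\<close>.\<close>
  have "((\<lambda>\<epsilon>. 2 * \<epsilon> + (exp (2 * \<epsilon>) / (1 - \<epsilon>) - 1)) \<longlongrightarrow> 2 * 0 + (exp (2 * 0) / (1 - 0) - 1)) (at_right (0::real))"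
    by (intro tendsto_intros) auto
  then have "\<forall>\<^sub>F \<epsilon> in at_right 0. 2 * \<epsilon> + (exp (2 * \<epsilon>) / (1 - \<epsilon>) - 1) < \<eta>"
    using \<eta> by (intro order_tendstoD) auto
  moreover have "\<forall>\<^sub>F \<epsilon> in at_right 0. 0 < \<epsilon> \<and> \<epsilon> < (1/20 :: real)"
    unfolding eventually_at_right_field by (rule exI[of _ "1/20"]) simp
  ultimately have "\<forall>\<^sub>F \<epsilon> in at_right (0::real). 2 * \<epsilon> + (exp (2 * \<epsilon>) / (1 - \<epsilon>) - 1) < \<eta> \<and> 0 < \<epsilon> \<and> \<epsilon> < 1/20"
    by eventually_elim auto
  then obtain \<epsilon> where \<epsilon>: "2 * \<epsilon> + (exp (2 * \<epsilon>) / (1 - \<epsilon>) - 1) < \<eta>" "0 < \<epsilon>" "\<epsilon> < 1/20"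
    using eventually_happens'[OF trivial_limit_at_right_real] by blast
  show ?thesis
  proof (rule exI[of _ \<epsilon>], intro conjI allI impI)
    fix R :: real assume R: "0 < R"
    define c where "c = 2 / (15 * L * R\<^sup>2)"
    define D where "D = 5 * L * R / (2 * m)"
    \<comment> \<open>Solves exp (- t/4) * sqrt (2^p) \<le> \<epsilon> in the Gaussian tail bound;
      the maximum with 1 keeps it positive.\<close>
    define t where "t = max 1 (4 * ln (sqrt (2 ^ CARD('p)) / \<epsilon>))"
    \<comment> \<open>D absorbs the offset of the mode, 4R is the radius of the shift argument, and
      at rescaled distance sqrt (t / (c m)) from the mode the form with precision at least c reaches
      t.\<close>
    define R' where "R' = D + 4 * R + sqrt (t / (c * m))"
    have c: "0 < c" "0 < D" "0 < t" using L m R by (auto simp: c_def D_def t_def)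
    have r0: "0 \<le> sqrt (t / (c * m))" using c m by simp
    then have R': "4 * R \<le> R'" using c by (simp add: R'_def)
    have "sqrt (2 ^ CARD('p)) / \<epsilon> \<le> exp (t / 4)"
      using \<epsilon>(2) by (subst ln_le_cancel_iff[symmetric]) (auto simp: t_def)
    then have tail: "exp (- t / 4) * sqrt (2 ^ CARD('p)) \<le> \<epsilon>"
      using \<epsilon>(2) by (simp add: exp_minus field_simps)
    show "\<exists>R'>0. forces_gaussian V \<epsilon> R R' \<eta>"
      unfolding forces_gaussian_def
    proof (intro exI[of _ R'] conjI allI impI)
      show "0 < R'" using R R' by simp
      fix a s \<theta>s \<theta>h Z and f :: "real^'p \<Rightarrow> real"
      assume pos: "0 < a" "0 < s" "0 < (Z::real)" and f0: "\<forall>\<theta>. 0 \<le> f \<theta>"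
        and f: "has_bochner_integral lborel f 1"
        and mass: "(LINT \<theta>|lborel. indicator (- cball \<theta>s (R / s)) \<theta> * f \<theta>) \<le> \<epsilon>"
        and near: "\<forall>\<theta>\<in>cball \<theta>s (R' / s).
          exp (- \<epsilon>) * Z * exp (- (1/2) * (a * s\<^sup>2 * ((\<theta> - \<theta>h) \<bullet> (V *v (\<theta> - \<theta>h))))) \<le> f \<theta> \<and>
          f \<theta> \<le> exp \<epsilon> * Z * exp (- (1/2) * (a * s\<^sup>2 * ((\<theta> - \<theta>h) \<bullet> (V *v (\<theta> - \<theta>h)))))"
      have sub: "cball \<theta>s (R'' / s) \<subseteq> cball \<theta>s (R' / s)" if "R'' \<le> R'" for R''
        using that pos by (intro subset_cball divide_right_mono) auto
      have near4: "exp (- \<epsilon>) * Z * exp (- (1/2) * (a * s\<^sup>2 * ((\<theta> - \<theta>h) \<bullet> (V *v (\<theta> - \<theta>h))))) \<le> f \<theta>"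
          "f \<theta> \<le> exp \<epsilon> * Z * exp (- (1/2) * (a * s\<^sup>2 * ((\<theta> - \<theta>h) \<bullet> (V *v (\<theta> - \<theta>h)))))"
        if "\<theta> \<in> cball \<theta>s (4 * R / s)" for \<theta>
        using near subsetD[OF sub[OF R'] that] by auto
      note params = gaussian_parameters_bounded[OF V m L R pos less_imp_le[OF \<epsilon>(3)] spec[OF f0] f mass near4]
      have ac: "c \<le> a" unfolding c_def by (rule params(1))
      have dD: "s * norm (\<theta>h - \<theta>s) \<le> D" unfolding D_def by (rule params(2))
      let ?W = "(a * s\<^sup>2) *\<^sub>R V" and ?B = "cball \<theta>s (R' / s)"
      have W: "pos_def_mat ?W" using pos by (intro pos_def_mat_scaleR[OF V]) auto
      have gtail: "(LINT \<theta>|lborel. indicator (- ?B) \<theta> * normal_density \<theta>h (matrix_inv ?W) \<theta>) \<le> \<epsilon>"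
      proof (rule order_trans[OF normal_density_tail[OF W] tail])
        fix \<theta> assume "\<theta> \<in> - ?B"
        then have "R' / s < norm (\<theta> - \<theta>s)" by (simp add: dist_norm norm_minus_commute)
        then have "R' < s * norm (\<theta> - \<theta>s)" using pos by (simp add: field_simps)
        also have "\<dots> \<le> s * (norm (\<theta> - \<theta>h) + norm (\<theta>h - \<theta>s))"
          using norm_triangle_ineq[of "\<theta> - \<theta>h" "\<theta>h - \<theta>s"] pos by (intro mult_left_mono) auto
        finally have "sqrt (t / (c * m)) \<le> s * norm (\<theta> - \<theta>h)"
          using dD R by (simp add: R'_def algebra_simps)
        then have "t / (c * m) \<le> (s * norm (\<theta> - \<theta>h))\<^sup>2"
          using power_mono[OF _ r0, of "s * norm (\<theta> - \<theta>h)" 2] c m by (simp add: real_sqrt_pow2)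
        then have "t \<le> c * s\<^sup>2 * (m * (norm (\<theta> - \<theta>h))\<^sup>2)"
          using c m by (simp add: field_simps)
        also have "\<dots> \<le> a * s\<^sup>2 * ((\<theta> - \<theta>h) \<bullet> (V *v (\<theta> - \<theta>h)))"
          using ac c m by (intro mult_mono) (auto intro!: mult_right_mono)
        finally show "t \<le> (\<theta> - \<theta>h) \<bullet> (?W *v (\<theta> - \<theta>h))"
          by (simp add: scaleR_matrix_vector_assoc[symmetric])
      qed simp
      have ftail: "(LINT \<theta>|lborel. indicator (- ?B) \<theta> * f \<theta>) \<le> \<epsilon>"
      proof (rule order_trans[OF integral_mono mass])
        have "R \<le> R'" using R R' by simp
        show "indicator (- ?B) \<theta> * f \<theta> \<le> indicator (- cball \<theta>s (R / s)) \<theta> * f \<theta>" for \<theta>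
          using sub[OF \<open>R \<le> R'\<close>] f0 by (auto simp: indicator_def)
      qed (use integrable_mult_indicator[OF _ integrable.intros[OF f]] in simp_all)
      \<comment> \<open>\<open>Z\<close> multiplies an unnormalised Gaussian; against the normal
        density the factor becomes \<open>Z * C\<close>.\<close>
      define C where "C = sqrt ((2 * pi) ^ CARD('p) / det ?W)"
      have C: "0 < C" using pos_def_mat_det_pos[OF W] by (simp add: C_def)
      have nd: "Z * exp (- (1/2) * (a * s\<^sup>2 * ((\<theta> - \<theta>h) \<bullet> (V *v (\<theta> - \<theta>h))))) = Z * C * normal_density \<theta>h (matrix_inv ?W) \<theta>" for \<theta>
        unfolding normal_density_precision[OF W] C_def[symmetric]
        using C by (simp add: scaleR_matrix_vector_assoc[symmetric])
      have "(LINT \<theta>|lborel. \<bar>f \<theta> - normal_density \<theta>h (matrix_inv ?W) \<theta>\<bar>) \<le> 2 * \<epsilon> + (exp (2 * \<epsilon>) / (1 - \<epsilon>) - 1)"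
      proof (rule L1_dist_le[OF f has_bochner_integral_normal_density[OF W]])
        show "0 < Z * C" using pos C by simp
        show "0 \<le> normal_density \<theta>h (matrix_inv ?W) x" for x
          unfolding normal_density_precision[OF W] C_def[symmetric] using C by simp
        show "exp (- \<epsilon>) * (Z * C) * normal_density \<theta>h (matrix_inv ?W) \<theta> \<le> f \<theta>"
          "f \<theta> \<le> exp \<epsilon> * (Z * C) * normal_density \<theta>h (matrix_inv ?W) \<theta>" if "\<theta> \<in> ?B" for \<theta>
          using bspec[OF near that] nd[of \<theta>] by (simp_all only: mult.assoc)
      qed (use f0 \<epsilon> ftail gtail in auto)
      with \<epsilon>(1) show "(LINT \<theta>|lborel. \<bar>f \<theta> - normal_density \<theta>h (matrix_inv ?W) \<theta>\<bar>) \<le> \<eta>" by simp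
    qed
  qed (fact \<epsilon>(2))
qed

section \<open>Concentration and the LAN expansion\<close>

text \<open>If no fixed radius works, radii growing slowly along a sequence of bad indices violate the
  hypothesis.\<close>
lemma eventually_le_at_fixed_radius:
  fixes e :: "nat \<Rightarrow> real \<Rightarrow> real"
  assumes lim: "\<And>r. filterlim r at_top sequentially \<Longrightarrow> (\<lambda>n. e n (r n)) \<longlonglongrightarrow> 0" and "0 < \<eta>"
  shows "\<exists>R>0. \<forall>\<^sub>F n in sequentially. e n R \<le> \<eta>"
proof (rule ccontr)
  assume none: "\<not> ?thesis"
  have bad: "\<exists>\<^sub>F n in sequentially. \<eta> < e n R" if "0 < R" for R
    using none that unfolding frequently_def by (simp only: not_less) blast
  \<comment> \<open>Bad indices occur infinitely often for every radius, so they can be picked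
    strictly increasing, the k-th one bad for radius k + 1.\<close>
  have "\<exists>\<sigma>. \<forall>k. \<eta> < e (\<sigma> k) (real (Suc k)) \<and> \<sigma> k < \<sigma> (Suc k)"
  proof (rule dependent_nat_choice)
    show "\<exists>n. \<eta> < e n (real (Suc 0))"
      using frequently_ex[OF bad[of "real (Suc 0)"]] by simp
    show "\<exists>n'. \<eta> < e n' (real (Suc (Suc k))) \<and> n < n'" for n k
    proof -
      have "\<exists>n'\<ge>Suc n. \<eta> < e n' (real (Suc (Suc k)))"
        using bad[of "real (Suc (Suc k))"] unfolding frequently_sequentially by simp
      then show ?thesis by (auto simp: Suc_le_eq)
    qed
  qed
  then obtain \<sigma> where \<sigma>: "\<And>k. \<eta> < e (\<sigma> k) (real (Suc k))" "strict_mono \<sigma>"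
    by (auto simp: strict_mono_Suc_iff)
  \<comment> \<open>The radius is k + 1 at the bad index \<open>\<sigma> k\<close>; the value n
    elsewhere only ensures divergence.\<close>
  define r where "r n = (if n \<in> range \<sigma> then real (Suc (inv \<sigma> n)) else real n)" for n
  have r\<sigma>: "r (\<sigma> k) = real (Suc k)" for k
    using strict_mono_imp_inj_on[OF \<sigma>(2)] by (simp add: r_def)
  have "filterlim r at_top sequentially"
    unfolding filterlim_at_top_gt[where c=0]
  proof (intro allI impI)
    fix K :: real assume "0 < K"
    obtain k where k: "K \<le> real k" using real_arch_simple by blast
    show "\<forall>\<^sub>F n in sequentially. K \<le> r n"
      using eventually_ge_at_top[of "max k (\<sigma> k)"]
    proof eventually_elim
      case (elim n)
      show ?case
      proof (cases "n \<in> range \<sigma>")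
        case True
        then obtain j where j: "n = \<sigma> j" by blast
        then have "k \<le> j" using elim strict_mono_less_eq[OF \<sigma>(2)] by simp
        then show ?thesis using k by (simp add: j r\<sigma>)
      qed (use elim k in \<open>simp add: r_def\<close>)
    qed
  qed
  then have "(\<lambda>n. e n (r n)) \<longlonglongrightarrow> 0" by (rule lim)
  then have "(\<lambda>k. e (\<sigma> k) (r (\<sigma> k))) \<longlonglongrightarrow> 0"
    using LIMSEQ_subseq_LIMSEQ[OF _ \<sigma>(2)] by (simp add: o_def)
  then have "\<forall>\<^sub>F k in sequentially. e (\<sigma> k) (r (\<sigma> k)) < \<eta>"
    using \<open>0 < \<eta>\<close> by (rule order_tendstoD)
  then obtain k where "e (\<sigma> k) (r (\<sigma> k)) < \<eta>"
    using eventually_happens'[OF sequentially_bot] by blast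
  then show False using \<sigma>(1)[of k] by (simp add: r\<sigma>)
qed

text \<open>The square is completed in the LAN expansion.\<close>
lemma M_posterior_LAN:
  fixes V :: "real^'p^'p" and \<theta>s \<theta>h :: "real^'p"
  assumes V: "pos_def_mat V" and n: "0 < n" and \<theta>: "\<theta> \<in> \<Theta>" and \<pi>s: "\<pi> \<theta>s \<noteq> 0"
  shows "M_posterior \<Theta> \<pi> \<alpha> \<rho> x n \<theta> =
    (exp (- wloss \<alpha> \<rho> x n \<theta>s + (1/2) * (alpha_bar \<alpha> n * real n * ((\<theta>h - \<theta>s) \<bullet> (V *v (\<theta>h - \<theta>s)))))
        * \<pi> \<theta>s / post_norm \<Theta> \<pi> \<alpha> \<rho> x n)
    * (\<pi> \<theta> / \<pi> \<theta>s) * exp (LAN_rem \<alpha> \<rho> x V \<theta>s \<theta>h n (sqrt (real n) *\<^sub>R (\<theta> - \<theta>s)))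
    * exp (- (1/2) * (alpha_bar \<alpha> n * real n * ((\<theta> - \<theta>h) \<bullet> (V *v (\<theta> - \<theta>h)))))"
proof -
  define u where "u = \<theta> - \<theta>s"
  define d where "d = \<theta>h - \<theta>s"
  define b where "b = alpha_bar \<alpha> n * real n"
  define s where "s = sqrt (real n)"
  have s: "s * s = real n" "s \<noteq> 0" using n by (simp_all add: s_def)
  have \<theta>u: "\<theta>s + (1 / s) *\<^sub>R (s *\<^sub>R u) = \<theta>" using s by (simp add: u_def)
  have "LAN_rem \<alpha> \<rho> x V \<theta>s \<theta>h n (s *\<^sub>R u) = (wloss \<alpha> \<rho> x n \<theta>s - wloss \<alpha> \<rho> x n \<theta>)
      - (s *\<^sub>R u) \<bullet> (alpha_bar \<alpha> n *\<^sub>R (V *v (s *\<^sub>R d))) + (1/2) * ((s *\<^sub>R u) \<bullet> (alpha_bar \<alpha> n *\<^sub>R (V *v (s *\<^sub>R u))))"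
    unfolding LAN_rem_def s_def[symmetric] d_def[symmetric] \<theta>u
    by (simp add: wloss_def right_diff_distrib sum_subtractf)
  also have "\<dots> = (wloss \<alpha> \<rho> x n \<theta>s - wloss \<alpha> \<rho> x n \<theta>) - b * (u \<bullet> (V *v d)) + (1/2) * (b * (u \<bullet> (V *v u)))"
    unfolding b_def s(1)[symmetric] by (simp add: matrix_vector_mult_scaleR mult_ac)
  finally have rem: "LAN_rem \<alpha> \<rho> x V \<theta>s \<theta>h n (s *\<^sub>R u) = \<dots>" .
  have "\<theta> - \<theta>h = u - d" by (simp add: u_def d_def)
  then have q: "(\<theta> - \<theta>h) \<bullet> (V *v (\<theta> - \<theta>h)) = u \<bullet> (V *v u) - 2 * (u \<bullet> (V *v d)) + d \<bullet> (V *v d)"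
    using pos_def_mat_sym[OF V, of d u]
    by (simp only:) (simp add: matrix_vector_mult_diff_distrib inner_diff_left inner_diff_right)
  \<comment> \<open>Everything free of \<theta> goes into the first bracket, including the square of
    the offset \<open>d\<close>; it becomes the factor \<open>Z\<close> of the final
    argument.\<close>
  have "- wloss \<alpha> \<rho> x n \<theta> = (- wloss \<alpha> \<rho> x n \<theta>s + (1/2) * (b * (d \<bullet> (V *v d))))
      + (LAN_rem \<alpha> \<rho> x V \<theta>s \<theta>h n (s *\<^sub>R u) + - (1/2) * (b * ((\<theta> - \<theta>h) \<bullet> (V *v (\<theta> - \<theta>h)))))"
    unfolding rem q by (simp add: algebra_simps)
  then have "exp (- wloss \<alpha> \<rho> x n \<theta>) = exp (- wloss \<alpha> \<rho> x n \<theta>s + (1/2) * (b * (d \<bullet> (V *v d))))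
      * (exp (LAN_rem \<alpha> \<rho> x V \<theta>s \<theta>h n (s *\<^sub>R u)) * exp (- (1/2) * (b * ((\<theta> - \<theta>h) \<bullet> (V *v (\<theta> - \<theta>h))))))"
    by (simp only: exp_add)
  then show ?thesis
    using \<theta> \<pi>s unfolding M_posterior_def b_def[symmetric] d_def[symmetric] u_def[symmetric] s_def[symmetric]
    by simp
qed

section \<open>Joint measurability in the sample point and the parameter\<close>

lemma measurable_loss_comp:
  assumes \<rho>: "(\<lambda>(x, \<theta>). \<rho> x \<theta>) \<in> borel_measurable (N \<Otimes>\<^sub>M lborel)" and X: "X \<in> measurable M N"
  shows "(\<lambda>(\<omega>, \<theta>). \<rho> (X \<omega>) \<theta>) \<in> borel_measurable (M \<Otimes>\<^sub>M lborel)"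
proof -
  have "(\<lambda>(\<omega>, \<theta>). (X \<omega>, \<theta>)) \<in> M \<Otimes>\<^sub>M lborel \<rightarrow>\<^sub>M N \<Otimes>\<^sub>M lborel"
    using X by measurable
  from measurable_compose[OF this \<rho>] show ?thesis by (simp add: case_prod_beta)
qed

text \<open>Joint measurability makes integrals over the parameter random variables; this is needed
  for Markov's inequality and for the event that the total variation distance is large.\<close>

lemma measurable_M_posterior:
  fixes \<rho> :: "'x \<Rightarrow> real^'p \<Rightarrow> real"
  assumes \<rho>: "(\<lambda>(x, \<theta>). \<rho> x \<theta>) \<in> borel_measurable (N \<Otimes>\<^sub>M lborel)" and X: "\<And>i. X i \<in> measurable M N"
    and \<pi>: "\<pi> \<in> borel_measurable lborel" and \<Theta>: "\<Theta> \<in> sets lborel"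
  shows "(\<lambda>(\<omega>, \<theta>). M_posterior \<Theta> \<pi> \<alpha> \<rho> (\<lambda>i. X i \<omega>) n \<theta>) \<in> borel_measurable (M \<Otimes>\<^sub>M lborel)"
proof -
  note [measurable] = measurable_loss_comp[OF \<rho> X]
  have [measurable]: "\<pi> \<in> borel_measurable borel" "\<Theta> \<in> sets borel" using \<pi> \<Theta> by auto
  have num [measurable]: "(\<lambda>(\<omega>, \<theta>). indicator \<Theta> \<theta> * exp (- wloss \<alpha> \<rho> (\<lambda>i. X i \<omega>) n \<theta>) * \<pi> \<theta>)
      \<in> borel_measurable (M \<Otimes>\<^sub>M lborel)"
    unfolding wloss_def by measurable
  have [measurable]: "(\<lambda>\<omega>. post_norm \<Theta> \<pi> \<alpha> \<rho> (\<lambda>i. X i \<omega>) n) \<in> borel_measurable M"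
    unfolding post_norm_def by (rule lborel.borel_measurable_lebesgue_integral[OF num])
  show ?thesis unfolding M_posterior_def by measurable
qed

lemma measurable_normal_density:
  fixes T :: "'a \<Rightarrow> real^'p"
  assumes T [measurable]: "T \<in> borel_measurable M"
  shows "(\<lambda>(\<omega>, \<theta>). normal_density (T \<omega>) \<Sigma> \<theta>) \<in> borel_measurable (M \<Otimes>\<^sub>M lborel)"
  unfolding normal_density_def by measurable

section \<open>From the deterministic bound to convergence in probability\<close>

theorem mainTheorem1:
  fixes M :: "'a measure" and N :: "'x measure" and P0 :: "'x measure"
    and X :: "nat \<Rightarrow> 'a \<Rightarrow> 'x"
    and \<Theta> :: "(real^'p) set" and \<theta>s :: "real^'p"
    and \<rho> :: "'x \<Rightarrow> real^'p \<Rightarrow> real" and \<psi> :: "'x \<Rightarrow> real^'p \<Rightarrow> real^'p"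
    and \<alpha> :: "nat \<Rightarrow> real" and \<pi> :: "real^'p \<Rightarrow> real"
    and thetahat :: "nat \<Rightarrow> 'a \<Rightarrow> real^'p" and V :: "real^'p^'p"
  assumes prob: "prob_space M"
    and X_meas: "\<And>i. X i \<in> measurable M N"
    and X_indep: "prob_space.indep_vars M (\<lambda>_. N) X UNIV"
    and X_distr: "\<And>i. distr M N (X i) = P0"
    and Theta_meas: "\<Theta> \<in> sets lborel"
    and interior: "\<theta>s \<in> interior \<Theta>"
    and rho_nonneg: "\<And>x \<theta>. 0 \<le> \<rho> x \<theta>"
    and rho_meas: "(\<lambda>(x, \<theta>). \<rho> x \<theta>) \<in> borel_measurable (N \<Otimes>\<^sub>M lborel)"
    and score: "\<And>x \<theta>. \<theta> \<in> interior \<Theta> \<Longrightarrow> (\<rho> x has_derivative (\<lambda>h. \<psi> x \<theta> \<bullet> h)) (at \<theta>)"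
    and est_meas: "\<And>n. thetahat n \<in> borel_measurable M"
    and est_solves: "\<And>n \<omega>. \<omega> \<in> space M \<Longrightarrow>
          thetahat n \<omega> \<in> \<Theta> \<and> (1 / real n) *\<^sub>R (\<Sum>i<n. \<alpha> i *\<^sub>R \<psi> (X i \<omega>) (thetahat n \<omega>)) = 0"
    and alpha_pos: "\<And>i. 0 < \<alpha> i"
    and alpha_moment: "limsup (\<lambda>n. ereal ((\<Sum>i<n. (\<alpha> i)\<^sup>2) / real n)) < \<infinity>"
    and prior_nonneg: "\<And>\<theta>. 0 \<le> \<pi> \<theta>"
    and prior_meas: "\<pi> \<in> borel_measurable lborel"
    and prior_dens: "set_integrable lborel \<Theta> \<pi>" "(LINT \<theta>:\<Theta>|lborel. \<pi> \<theta>) = 1"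
    and prior_local: "\<exists>U. open U \<and> \<theta>s \<in> U \<and> continuous_on U \<pi> \<and> (\<forall>\<theta>\<in>U. 0 < \<pi> \<theta>)"
    and post_proper: "\<And>n \<omega>. \<omega> \<in> space M \<Longrightarrow>
          integrable lborel (\<lambda>\<theta>. indicator \<Theta> \<theta> * exp (- wloss \<alpha> \<rho> (\<lambda>i. X i \<omega>) n \<theta>) * \<pi> \<theta>)
          \<and> 0 < post_norm \<Theta> \<pi> \<alpha> \<rho> (\<lambda>i. X i \<omega>) n"
    and V_pd: "pos_def_mat V"
    and LAN: "\<And>K. compact K \<Longrightarrow> sup_tendsto_zero_in_prob M K
          (\<lambda>n \<omega> h. LAN_rem \<alpha> \<rho> (\<lambda>i. X i \<omega>) V \<theta>s (thetahat n \<omega>) n h)"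
    and concentration: "\<And>r. filterlim r at_top sequentially \<Longrightarrow>
          (\<lambda>n. \<integral>\<omega>. (LINT \<theta>|lborel.
                 indicator {\<theta>. norm (sqrt (real n) *\<^sub>R (\<theta> - \<theta>s)) > r n} \<theta>
                 * M_posterior \<Theta> \<pi> \<alpha> \<rho> (\<lambda>i. X i \<omega>) n \<theta>) \<partial>M) \<longlonglongrightarrow> 0"
  shows "tendsto_zero_in_prob M (\<lambda>n \<omega>.
           dTV_dens (M_posterior \<Theta> \<pi> \<alpha> \<rho> (\<lambda>i. X i \<omega>) n)
                    (normal_density (thetahat n \<omega>) ((1 / (alpha_bar \<alpha> n * real n)) *\<^sub>R matrix_inv V)))"
  unfolding tendsto_zero_in_prob_def
proof (intro allI impI)
  interpret prob_space M by (rule prob)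
  fix \<epsilon>0 :: real assume \<epsilon>0: "0 < \<epsilon>0"
  let ?post = "\<lambda>n \<omega>. M_posterior \<Theta> \<pi> \<alpha> \<rho> (\<lambda>i. X i \<omega>) n"
  let ?gauss = "\<lambda>n \<omega>. normal_density (thetahat n \<omega>) ((1 / (alpha_bar \<alpha> n * real n)) *\<^sub>R matrix_inv V)"
  let ?D = "\<lambda>n \<omega>. dTV_dens (?post n \<omega>) (?gauss n \<omega>)"
  \<comment> \<open>Convergence in probability asks for a measurable cover; the event itself is
    measurable and is its own cover.\<close>
  define E where "E n = {\<omega> \<in> space M. \<epsilon>0 < \<bar>?D n \<omega>\<bar>}" for n
  define Q where "Q n R \<omega> = (LINT \<theta>|lborel. indicator {\<theta>. norm (sqrt (real n) *\<^sub>R (\<theta> - \<theta>s)) > R} \<theta> * ?post n \<omega> \<theta>)" for n R \<omega>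

  have post_meas [measurable]: "(\<lambda>(\<omega>, \<theta>). ?post n \<omega> \<theta>) \<in> borel_measurable (M \<Otimes>\<^sub>M lborel)" for n
    by (rule measurable_M_posterior[OF rho_meas X_meas prior_meas Theta_meas])
  have post_nonneg: "0 \<le> ?post n \<omega> \<theta>" if "\<omega> \<in> space M" for n \<omega> \<theta>
    using post_proper[OF that, of n] prior_nonneg[of \<theta>] by (simp add: M_posterior_def)
  have post_int: "has_bochner_integral lborel (?post n \<omega>) 1" if "\<omega> \<in> space M" for n \<omega>
  proof -
    have "has_bochner_integral lborel (\<lambda>\<theta>. indicator \<Theta> \<theta> * exp (- wloss \<alpha> \<rho> (\<lambda>i. X i \<omega>) n \<theta>) * \<pi> \<theta>)
        (post_norm \<Theta> \<pi> \<alpha> \<rho> (\<lambda>i. X i \<omega>) n)"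
      unfolding post_norm_def using post_proper[OF that, of n] by (intro has_bochner_integral_integrable) blast
    then have "has_bochner_integral lborel (?post n \<omega>)
        (post_norm \<Theta> \<pi> \<alpha> \<rho> (\<lambda>i. X i \<omega>) n / post_norm \<Theta> \<pi> \<alpha> \<rho> (\<lambda>i. X i \<omega>) n)"
      unfolding M_posterior_def[abs_def] by (rule has_bochner_integral_divide_zero)
    then show ?thesis using post_proper[OF that, of n] by simp
  qed
  have Q_meas [measurable]: "Q n R \<in> borel_measurable M" for n R
    unfolding Q_def by measurable
  have Q_bounds: "0 \<le> Q n R \<omega>" "Q n R \<omega> \<le> 1" if \<omega>: "\<omega> \<in> space M" for n R \<omega>
  proof -
    show "0 \<le> Q n R \<omega>"
      unfolding Q_def using post_nonneg[OF \<omega>] by (intro Bochner_Integration.integral_nonneg) simp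
    have S: "{\<theta>. norm (sqrt (real n) *\<^sub>R (\<theta> - \<theta>s)) > R} \<in> sets lborel" by measurable
    have "Q n R \<omega> \<le> (LINT \<theta>|lborel. ?post n \<omega> \<theta>)"
      unfolding Q_def
      using integrable_mult_indicator[OF S integrable.intros[OF post_int[OF \<omega>]]] post_nonneg[OF \<omega>]
      by (intro integral_mono integrable.intros[OF post_int[OF \<omega>]]) (auto simp: indicator_def)
    then show "Q n R \<omega> \<le> 1" using has_bochner_integral_integral_eq[OF post_int[OF \<omega>]] by simp
  qed
  have Q_int: "integrable M (Q n R)" for n R
    by (rule integrable_const_bound[of _ 1]) (use Q_bounds in \<open>auto intro!: AE_I2\<close>)

  have E_sets: "E n \<in> sets M" for n
  proof -
    have [measurable]: "(\<lambda>(\<omega>, \<theta>). ?gauss n \<omega> \<theta>) \<in> borel_measurable (M \<Otimes>\<^sub>M lborel)"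
      by (rule measurable_normal_density[OF est_meas])
    have [measurable]: "(\<lambda>\<omega>. LINT \<theta>|lborel. \<bar>?post n \<omega> \<theta> - ?gauss n \<omega> \<theta>\<bar>) \<in> borel_measurable M"
      by measurable
    show ?thesis unfolding E_def dTV_dens_def by measurable
  qed

  have "(\<lambda>n. measure M (E n)) \<longlonglongrightarrow> 0"
  proof (rule order_tendstoI)
    show "\<forall>\<^sub>F n in sequentially. a < measure M (E n)" if "a < 0" for a
      using that by (intro always_eventually) (meson less_le_trans measure_nonneg)
    fix e :: real assume e: "0 < e"
    obtain \<epsilon> where \<epsilon>: "0 < \<epsilon>" and approx: "\<And>R. 0 < R \<Longrightarrow> \<exists>R'>0. forces_gaussian V \<epsilon> R R' \<epsilon>0"
      using gaussian_approximation[OF V_pd \<epsilon>0] by auto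
    \<comment> \<open>With this budget Markov's inequality at level \<epsilon> costs at most e/4;
      the LAN event will cost less than e/2, in total less than e.\<close>
    have "0 < \<epsilon> * e / 4" using \<epsilon> e by simp
    have "\<exists>R>0. \<forall>\<^sub>F n in sequentially. (\<integral>\<omega>. Q n R \<omega> \<partial>M) \<le> \<epsilon> * e / 4"
      using concentration \<open>0 < \<epsilon> * e / 4\<close> unfolding Q_def[symmetric] by (rule eventually_le_at_fixed_radius)
    then obtain R where R: "0 < R" "\<forall>\<^sub>F n in sequentially. (\<integral>\<omega>. Q n R \<omega> \<partial>M) \<le> \<epsilon> * e / 4"
      by blast
    obtain R' where R': "0 < R'" and forces: "forces_gaussian V \<epsilon> R R' \<epsilon>0"
      using approx[OF R(1)] by auto
    \<comment> \<open>The tolerance \<epsilon> in the exponent is split evenly between the LAN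
      remainder and the logarithm of the prior ratio.\<close>
    have "0 < \<epsilon> / 2" using \<epsilon> by simp
    from LAN[OF compact_cball, of 0 R', unfolded sup_tendsto_zero_in_prob_def, rule_format, OF this]
    obtain E' where E'_sets: "\<And>n. E' n \<in> sets M"
      and E'_sub: "\<And>n. {\<omega> \<in> space M. \<exists>h\<in>cball 0 R'. \<epsilon> / 2 < \<bar>LAN_rem \<alpha> \<rho> (\<lambda>i. X i \<omega>) V \<theta>s (thetahat n \<omega>) n h\<bar>} \<subseteq> E' n"
      and E'_lim: "(\<lambda>n. measure M (E' n)) \<longlonglongrightarrow> 0"
      by auto
    have E': "\<bar>LAN_rem \<alpha> \<rho> (\<lambda>i. X i \<omega>) V \<theta>s (thetahat n \<omega>) n h\<bar> \<le> \<epsilon> / 2"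
      if "\<omega> \<in> space M" "\<omega> \<notin> E' n" "norm h \<le> R'" for n \<omega> h
    proof (rule ccontr)
      assume "\<not> ?thesis"
      then have "\<omega> \<in> {\<omega> \<in> space M. \<exists>h\<in>cball 0 R'. \<epsilon> / 2 < \<bar>LAN_rem \<alpha> \<rho> (\<lambda>i. X i \<omega>) V \<theta>s (thetahat n \<omega>) n h\<bar>}"
        using that by (auto simp: not_le)
      then show False using E'_sub that(2) by blast
    qed
    obtain U where U: "open U" "\<theta>s \<in> U" "continuous_on U \<pi>" "\<And>\<theta>. \<theta> \<in> U \<Longrightarrow> 0 < \<pi> \<theta>"
      using prior_local by blast
    have \<pi>s: "0 < \<pi> \<theta>s" using U by simp
    \<comment> \<open>Interiority enters here: the posterior vanishes off \<Theta>, so the expansion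
      describes it only where the shrinking ball lies inside \<Theta>.\<close>
    have "\<forall>\<^sub>F \<theta> in nhds \<theta>s. \<theta> \<in> \<Theta> \<and> exp (- \<epsilon> / 2) \<le> \<pi> \<theta> / \<pi> \<theta>s \<and> \<pi> \<theta> / \<pi> \<theta>s \<le> exp (\<epsilon> / 2)"
    proof -
      have "isCont \<pi> \<theta>s" using U continuous_on_eq_continuous_at by blast
      then have "((\<lambda>\<theta>. \<pi> \<theta> / \<pi> \<theta>s) \<longlongrightarrow> \<pi> \<theta>s / \<pi> \<theta>s) (nhds \<theta>s)"
        using \<pi>s by (intro tendsto_intros) (auto simp: isCont_def tendsto_at_iff_tendsto_nhds)
      then have lim: "((\<lambda>\<theta>. \<pi> \<theta> / \<pi> \<theta>s) \<longlongrightarrow> 1) (nhds \<theta>s)" using \<pi>s by simp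
      have "\<forall>\<^sub>F \<theta> in nhds \<theta>s. exp (- \<epsilon> / 2) < \<pi> \<theta> / \<pi> \<theta>s" "\<forall>\<^sub>F \<theta> in nhds \<theta>s. \<pi> \<theta> / \<pi> \<theta>s < exp (\<epsilon> / 2)"
        using \<epsilon> by (auto intro: order_tendstoD[OF lim])
      moreover have "\<forall>\<^sub>F \<theta> in nhds \<theta>s. \<theta> \<in> \<Theta>"
        using interior by (metis eventually_nhds interior_subset open_interior subsetD)
      ultimately show ?thesis by eventually_elim auto
    qed
    then obtain r where r: "0 < r" and near: "\<And>\<theta>. dist \<theta> \<theta>s < r \<Longrightarrow> \<theta> \<in> \<Theta>"
      "\<And>\<theta>. dist \<theta> \<theta>s < r \<Longrightarrow> exp (- \<epsilon> / 2) \<le> \<pi> \<theta> / \<pi> \<theta>s" "\<And>\<theta>. dist \<theta> \<theta>s < r \<Longrightarrow> \<pi> \<theta> / \<pi> \<theta>s \<le> exp (\<epsilon> / 2)"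
      unfolding eventually_nhds_metric by blast
    have "(\<lambda>n. R' / sqrt (real n)) \<longlonglongrightarrow> 0"
      by (intro real_tendsto_divide_at_top[OF tendsto_const] filterlim_compose[OF sqrt_at_top filterlim_real_sequentially])
    then have "\<forall>\<^sub>F n in sequentially. R' / sqrt (real n) < r" using r by (rule order_tendstoD)
    moreover have "\<forall>\<^sub>F n in sequentially. measure M (E' n) < e / 2" using e by (intro order_tendstoD[OF E'_lim]) simp
    ultimately show "\<forall>\<^sub>F n in sequentially. measure M (E n) < e"
      \<comment> \<open>The index 0 is excluded because \<open>alpha_bar \<alpha> 0\<close> is 0 by
        the division convention.\<close>
      using R(2) eventually_gt_at_top[of 0]
    proof eventually_elim
      case (elim n)
      define s where "s = sqrt (real n)"
      have s: "0 < s" "s\<^sup>2 = real n" using elim by (simp_all add: s_def)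
      have a: "0 < alpha_bar \<alpha> n"
        using elim alpha_pos unfolding alpha_bar_def by (intro divide_pos_pos sum_pos) auto
      define B where "B = {\<omega> \<in> space M. \<epsilon> \<le> Q n R \<omega>}"
      have B_sets: "B \<in> sets M" unfolding B_def by measurable
      have "measure M B \<le> (\<integral>\<omega>. Q n R \<omega> \<partial>M) / \<epsilon>"
        unfolding B_def using \<epsilon> Q_bounds
        by (intro integral_Markov_inequality_measure[OF Q_int, of "{}"]) (auto intro!: AE_I2)
      also have "\<dots> \<le> e / 4" using elim \<epsilon> by (simp add: field_simps)
      finally have B: "measure M B \<le> e / 4" .
      \<comment> \<open>Off both exceptional events the hypotheses of \<open>forces_gaussian\<close>
        hold for this single sample point.\<close>
      have "E n \<subseteq> B \<union> E' n"
      proof (rule ccontr)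
        assume "\<not> ?thesis"
        then obtain \<omega> where \<omega>: "\<omega> \<in> space M" "\<epsilon>0 < \<bar>?D n \<omega>\<bar>" "\<omega> \<notin> B" "\<omega> \<notin> E' n"
          by (auto simp: E_def)
        let ?f = "?post n \<omega>" and ?th = "thetahat n \<omega>" and ?x = "\<lambda>i. X i \<omega>"
        \<comment> \<open>The \<theta>-free factor of \<open>M_posterior_LAN\<close>. It depends on
          the sample and on n, which is harmless since only its positivity is required.\<close>
        define Z where "Z = exp (- wloss \<alpha> \<rho> ?x n \<theta>s + (1/2) * (alpha_bar \<alpha> n * real n * ((?th - \<theta>s) \<bullet> (V *v (?th - \<theta>s)))))
          * \<pi> \<theta>s / post_norm \<Theta> \<pi> \<alpha> \<rho> ?x n"
        have Z: "0 < Z" unfolding Z_def using \<pi>s post_proper[OF \<omega>(1)] by (intro divide_pos_pos mult_pos_pos) auto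
        have "(LINT \<theta>|lborel. \<bar>?f \<theta> - normal_density ?th (matrix_inv ((alpha_bar \<alpha> n * s\<^sup>2) *\<^sub>R V)) \<theta>\<bar>) \<le> \<epsilon>0"
        proof (rule forces_gaussianD[OF forces a s(1) Z post_nonneg[OF \<omega>(1)] post_int[OF \<omega>(1)]])
          have "- cball \<theta>s (R / s) = {\<theta>. norm (sqrt (real n) *\<^sub>R (\<theta> - \<theta>s)) > R}"
            using s(1) by (auto simp: s_def[symmetric] dist_norm norm_minus_commute pos_le_divide_eq mult.commute not_le)
          then show "(LINT \<theta>|lborel. indicator (- cball \<theta>s (R / s)) \<theta> * ?f \<theta>) \<le> \<epsilon>"
            using \<omega>(1,3) by (simp add: B_def Q_def)
          fix \<theta> assume "\<theta> \<in> cball \<theta>s (R' / s)"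
          then have \<theta>: "dist \<theta> \<theta>s \<le> R' / s" by (simp add: dist_commute)
          then have \<theta>r: "dist \<theta> \<theta>s < r" using elim by (simp add: s_def)
          let ?w = "\<pi> \<theta> / \<pi> \<theta>s" and ?rem = "LAN_rem \<alpha> \<rho> ?x V \<theta>s ?th n (sqrt (real n) *\<^sub>R (\<theta> - \<theta>s))"
          let ?g = "exp (- (1/2) * (alpha_bar \<alpha> n * s\<^sup>2 * ((\<theta> - ?th) \<bullet> (V *v (\<theta> - ?th)))))"
          have f: "?f \<theta> = (?w * exp ?rem) * (Z * ?g)"
            using M_posterior_LAN[OF V_pd _ near(1)[OF \<theta>r], of n \<pi> \<theta>s \<alpha> \<rho> ?x ?th] \<pi>s elim
            unfolding Z_def s(2) by (simp only: mult_ac)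
          have "norm (sqrt (real n) *\<^sub>R (\<theta> - \<theta>s)) \<le> R'"
            using \<theta> s(1) by (simp add: s_def[symmetric] dist_norm pos_le_divide_eq mult.commute)
          then have rem: "\<bar>?rem\<bar> \<le> \<epsilon> / 2" by (rule E'[OF \<omega>(1,4)])
          have "exp (- \<epsilon> / 2) * exp (- \<epsilon> / 2) \<le> ?w * exp ?rem"
            using near(2)[OF \<theta>r] rem by (intro mult_mono) (auto intro: order_trans[OF exp_ge_zero])
          then have lo: "exp (- \<epsilon>) \<le> ?w * exp ?rem" by (simp add: exp_add[symmetric])
          have "?w * exp ?rem \<le> exp (\<epsilon> / 2) * exp (\<epsilon> / 2)"
            using near(3)[OF \<theta>r] rem by (intro mult_mono) auto
          then have up: "?w * exp ?rem \<le> exp \<epsilon>" by (simp add: exp_add[symmetric])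
          show "exp (- \<epsilon>) * Z * ?g \<le> ?f \<theta> \<and> ?f \<theta> \<le> exp \<epsilon> * Z * ?g"
            unfolding f mult.assoc[of "exp _" Z] using lo up Z
            by (intro conjI mult_right_mono) auto
        qed
        moreover have "matrix_inv ((alpha_bar \<alpha> n * s\<^sup>2) *\<^sub>R V) = (1 / (alpha_bar \<alpha> n * real n)) *\<^sub>R matrix_inv V"
          unfolding s(2) using a elim by (intro pos_def_mat_inverse(3)[OF V_pd, symmetric]) simp
        ultimately have "(LINT \<theta>|lborel. \<bar>?f \<theta> - ?gauss n \<omega> \<theta>\<bar>) \<le> \<epsilon>0" by simp
        moreover have "0 \<le> (LINT \<theta>|lborel. \<bar>?f \<theta> - ?gauss n \<omega> \<theta>\<bar>)" by simp
        ultimately show False using \<omega>(2) \<epsilon>0 by (simp add: dTV_dens_def)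
      qed
      then have "measure M (E n) \<le> measure M (B \<union> E' n)"
        using B_sets E'_sets by (intro finite_measure_mono) auto
      also have "\<dots> \<le> measure M B + measure M (E' n)"
        using B_sets E'_sets by (intro measure_Un_le)
      finally show ?case using B elim e by linarith
    qed
  qed
  then show "\<exists>E. (\<forall>n. E n \<in> sets M \<and> {\<omega> \<in> space M. \<epsilon>0 < \<bar>?D n \<omega>\<bar>} \<subseteq> E n) \<and> (\<lambda>n. measure M (E n)) \<longlonglongrightarrow> 0"
    using E_sets by (intro exI[of _ E]) (simp add: E_def)
qed

end
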